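(* Let $G\subset\mathbb{K}[x_1,\dots,x_n][\partial_1,\dots,\partial_n]$ be a finite set which is a Gröbner basis with respect to $\prec$, such that every element of $G$ is primitive and the left ideal $\mathbb{K}(\mathbf{x})[\boldsymbol{\partial}]G$ is D-finite. Then the origin is an ordinary point of $G$ if and only if $G$ has $\mathrm{rank}(G)$ many $\mathbb{K}$-linearly independent formal power series solutions in $\mathbb{K}[[x_1,\dots,x_n]]$ whose initial exponents are exactly the elements of $\mathrm{PE}(G)$.
   Context: $\mathbb{K}$ is a field of characteristic zero. $\mathbb{K}(\mathbf{x})[\boldsymbol{\partial}]=\mathbb{K}(x_1,\dots,x_n)[\partial_1,\dots,\partial_n]$ is the ring of differential operators with rational function coefficients ($\partial_i\partial_j=\partial_j\partial_i$, $\partial_i f=f\partial_i+\partial f/\partial x_i$), and $\mathbb{K}[\mathbf{x}][\boldsymbol{\partial}]$ the subring with polynomial coefficients. A left ideal $I$ of $\mathbb{K}(\mathbf{x})[\boldsymbol{\partial}]$ is D-finite if $\mathbb{K}(\mathbf{x})[\boldsymbol{\partial}]/I$ is a finite-dimensional $\mathbb{K}(\mathbf{x})$-vector space. $\prec$ is a fixed graded term order on $\mathbb{N}^n$ (a total order compatible with addition, refining total degree), used both on terms $\boldsymbol{\partial}^{\mathbf{u}}$ and on terms $\mathbf{x}^{\mathbf{u}}$. Gröbner bases are taken in $\mathbb{K}(\mathbf{x})[\boldsymbol{\partial}]$ with respect to $\prec$ on $\boldsymbol{\partial}$-terms (reduced, up to multiplying elements by nonzero polynomials); for $P$ in $G$,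 its head term is its $\prec$-largest $\boldsymbol{\partial}$-term and its head coefficient (in $\mathbb{K}[\mathbf{x}]$) the coefficient of that term. Parametric terms $\mathrm{PT}(G)$ are the $\boldsymbol{\partial}$-terms not divisible by any head term of $G$; $\mathrm{rank}(G)=|\mathrm{PT}(G)|$; $\mathrm{PE}(G)$ is the set of exponent vectors of elements of $\mathrm{PT}(G)$. A point of $\overline{\mathbb{K}}^n$ is a singularity of $G=\{G_1,\dots,G_k\}$ if it is a zero of $\mathrm{lcm}$ of the head coefficients of $G_1,\dots,G_k$, and an ordinary point otherwise. An operator $\sum c_{\mathbf{u}}\boldsymbol{\partial}^{\mathbf{u}}$ with $c_{\mathbf{u}}\in\mathbb{K}[\mathbf{x}]$ is primitive if the gcd of its coefficients $c_{\mathbf{u}}$ is $1$. The initial exponent of a nonzero $f\in\mathbb{K}[[\mathbf{x}]]$ is the $\prec$-smallest exponent $\mathbf{w}$ with nonzero coefficient of $\mathbf{x}^{\mathbf{w}}$ in $f$. A formal power series solution of $G$ is $f\in\mathbb{K}[[\mathbf{x}]]$ with $P(f)=0$ for all $P\in G$. *)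

theory Defs
  imports Main
begin

text \<open>Variables x_1..x_n are indexed by a finite type 'v. Exponent vectors are 'v => nat.
 Multivariate polynomials / formal power series over 'a are functions from exponent vectors
 to coefficients (polynomials = finite support). Operators in K[x][d] are functions from
 d-exponent vectors to polynomial coefficients, with finite support.\<close>

type_synonym 'v mon = "'v \<Rightarrow> nat"
type_synonym ('v, 'a) ser = "'v mon \<Rightarrow> 'a"
type_synonym ('v, 'a) dop = "'v mon \<Rightarrow> ('v, 'a) ser"

definition is_poly :: "('v, 'a::zero) ser \<Rightarrow> bool" where
  "is_poly c \<longleftrightarrow> finite {w. c w \<noteq> 0}"

definition dsupp :: "('v, 'a::zero) dop \<Rightarrow> 'v mon set" where
  "dsupp P = {u. P u \<noteq> (\<lambda>_. 0)}"

definition is_dop :: "('v, 'a::zero) dop \<Rightarrow> bool" where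
  "is_dop P \<longleftrightarrow> finite (dsupp P) \<and> (\<forall>u. is_poly (P u))"

definition pmul :: "('v::finite, 'a::comm_ring_1) ser \<Rightarrow> ('v, 'a) ser \<Rightarrow> ('v, 'a) ser" where
  "pmul c d = (\<lambda>w. \<Sum>a\<in>{a. a \<le> w}. c a * d (\<lambda>i. w i - a i))"

definition pderivs :: "'v::finite mon \<Rightarrow> ('v, 'a::comm_ring_1) ser \<Rightarrow> ('v, 'a) ser" where
  "pderivs k c = (\<lambda>w. of_nat (\<Prod>i\<in>UNIV. fact (w i + k i) div fact (w i)) * c (\<lambda>i. w i + k i))"

definition mbinom :: "'v::finite mon \<Rightarrow> 'v mon \<Rightarrow> nat" where
  "mbinom u k = (\<Prod>i\<in>UNIV. u i choose k i)"

text \<open>Multiplication in K[x][d] (Leibniz rule d^u r = sum_{k<=u} binom(u,k) (d^k r) d^(u-k)).\<close>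
definition dmul :: "('v::finite, 'a::comm_ring_1) dop \<Rightarrow> ('v, 'a) dop \<Rightarrow> ('v, 'a) dop" where
  "dmul P R = (\<lambda>w x. \<Sum>u\<in>dsupp P. \<Sum>k\<in>{k. k \<le> u \<and> (\<lambda>i. u i - k i) \<le> w}.
      of_nat (mbinom u k) * pmul (P u) (pderivs k (R (\<lambda>i. w i - (u i - k i)))) x)"

definition dlmul :: "('v::finite, 'a::comm_ring_1) ser \<Rightarrow> ('v, 'a) dop \<Rightarrow> ('v, 'a) dop" where
  "dlmul q L = (\<lambda>u. pmul q (L u))"

definition dapply :: "('v::finite, 'a::comm_ring_1) dop \<Rightarrow> ('v, 'a) ser \<Rightarrow> ('v, 'a) ser" where
  "dapply P f = (\<lambda>w. \<Sum>u\<in>dsupp P. pmul (P u) (pderivs u f) w)"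

text \<open>An operator L with polynomial coefficients lies in the left ideal K(x)[d] G iff
 some nonzero polynomial multiple q L is a K[x][d]-combination of G (clearing denominators).\<close>
definition in_ideal :: "('v::finite, 'a::comm_ring_1) dop set \<Rightarrow> ('v, 'a) dop \<Rightarrow> bool" where
  "in_ideal G L \<longleftrightarrow> (\<exists>q. is_poly q \<and> q \<noteq> (\<lambda>_. 0) \<and>
      (\<exists>Q. (\<forall>g\<in>G. is_dop (Q g)) \<and> dlmul q L = (\<lambda>u w. \<Sum>g\<in>G. dmul (Q g) g u w)))"

definition graded_term_order :: "('v::finite mon \<Rightarrow> 'v mon \<Rightarrow> bool) \<Rightarrow> bool" where
  "graded_term_order ord \<longleftrightarrow>
     (\<forall>a. \<not> ord a a) \<and> (\<forall>a b c. ord a b \<longrightarrow> ord b c \<longrightarrow> ord a c) \<and>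
     (\<forall>a b. a \<noteq> b \<longrightarrow> ord a b \<or> ord b a) \<and>
     (\<forall>a b c. ord a b \<longrightarrow> ord (\<lambda>i. a i + c i) (\<lambda>i. b i + c i)) \<and>
     (\<forall>a b. (\<Sum>i\<in>UNIV. a i) < (\<Sum>i\<in>UNIV. b i) \<longrightarrow> ord a b)"

definition HT :: "('v mon \<Rightarrow> 'v mon \<Rightarrow> bool) \<Rightarrow> ('v, 'a::zero) dop \<Rightarrow> 'v mon" where
  "HT ord P = (THE u. u \<in> dsupp P \<and> (\<forall>v\<in>dsupp P. v \<noteq> u \<longrightarrow> ord v u))"

definition hc :: "('v mon \<Rightarrow> 'v mon \<Rightarrow> bool) \<Rightarrow> ('v, 'a::zero) dop \<Rightarrow> ('v, 'a) ser" where
  "hc ord P = P (HT ord P)"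

definition is_GB :: "('v::finite mon \<Rightarrow> 'v mon \<Rightarrow> bool) \<Rightarrow> ('v, 'a::comm_ring_1) dop set \<Rightarrow> bool" where
  "is_GB ord G \<longleftrightarrow> (\<forall>L. is_dop L \<and> L \<noteq> (\<lambda>_ _. 0) \<and> in_ideal G L \<longrightarrow>
                        (\<exists>g\<in>G. HT ord g \<le> HT ord L))"

text \<open>Reducedness (up to multiplying elements by nonzero polynomials).\<close>
definition is_reduced :: "('v::finite mon \<Rightarrow> 'v mon \<Rightarrow> bool) \<Rightarrow> ('v, 'a::comm_ring_1) dop set \<Rightarrow> bool" where
  "is_reduced ord G \<longleftrightarrow> (\<forall>P\<in>G. P \<noteq> (\<lambda>_ _. 0) \<and>
      (\<forall>u\<in>dsupp P. u \<noteq> HT ord P \<longrightarrow> (\<forall>Q\<in>G. \<not> HT ord Q \<le> u)) \<and>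
      (\<forall>Q\<in>G. Q \<noteq> P \<longrightarrow> \<not> HT ord Q \<le> HT ord P))"

text \<open>D-finiteness: K(x)[d]/I finite-dimensional over K(x), i.e. there is a bound N such that
 any more than N distinct d-terms are K(x)-linearly dependent modulo I (denominators cleared).\<close>
definition D_finite :: "('v::finite, 'a::comm_ring_1) dop set \<Rightarrow> bool" where
  "D_finite G \<longleftrightarrow> (\<exists>N::nat. \<forall>U. finite U \<and> card U > N \<longrightarrow>
      (\<exists>c. (\<forall>u\<in>U. is_poly (c u)) \<and> (\<exists>u\<in>U. c u \<noteq> (\<lambda>_. 0)) \<and>
           in_ideal G (\<lambda>v. if v \<in> U then c v else (\<lambda>_. 0))))"

definition PT :: "('v::finite mon \<Rightarrow> 'v mon \<Rightarrow> bool) \<Rightarrow> ('v, 'a::comm_ring_1) dop set \<Rightarrow> 'v mon set" where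
  "PT ord G = {u. \<forall>g\<in>G. \<not> HT ord g \<le> u}"

definition rank :: "('v::finite mon \<Rightarrow> 'v mon \<Rightarrow> bool) \<Rightarrow> ('v, 'a::comm_ring_1) dop set \<Rightarrow> nat" where
  "rank ord G = card (PT ord G)"

definition pdvd :: "('v::finite, 'a::comm_ring_1) ser \<Rightarrow> ('v, 'a) ser \<Rightarrow> bool" where
  "pdvd d c \<longleftrightarrow> (\<exists>r. is_poly r \<and> pmul d r = c)"

text \<open>Primitive: gcd of the coefficients is 1, i.e. every common polynomial divisor is a unit
 (a nonzero constant).\<close>
definition primitive :: "('v::finite, 'a::comm_ring_1) dop \<Rightarrow> bool" where
  "primitive P \<longleftrightarrow> (\<forall>d. is_poly d \<and> (\<forall>u\<in>dsupp P. pdvd d (P u)) \<longrightarrow>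
        d (\<lambda>_. 0) \<noteq> 0 \<and> (\<forall>w. w \<noteq> (\<lambda>_. 0) \<longrightarrow> d w = 0))"

definition is_plcm :: "('v::finite, 'a::comm_ring_1) ser \<Rightarrow> ('v, 'a) ser set \<Rightarrow> bool" where
  "is_plcm L S \<longleftrightarrow> is_poly L \<and> (\<forall>c\<in>S. pdvd c L) \<and>
      (\<forall>M. is_poly M \<and> (\<forall>c\<in>S. pdvd c M) \<longrightarrow> pdvd L M)"

text \<open>The origin is an ordinary point: the lcm of the head coefficients does not vanish at 0
 (evaluation at the origin = constant coefficient).\<close>
definition ordinary_origin :: "('v::finite mon \<Rightarrow> 'v mon \<Rightarrow> bool) \<Rightarrow> ('v, 'a::comm_ring_1) dop set \<Rightarrow> bool" where
  "ordinary_origin ord G \<longleftrightarrow> (\<exists>L. is_plcm L (hc ord ` G) \<and> L (\<lambda>_. 0) \<noteq> 0)"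

definition init_exp :: "('v mon \<Rightarrow> 'v mon \<Rightarrow> bool) \<Rightarrow> ('v, 'a::zero) ser \<Rightarrow> 'v mon" where
  "init_exp ord f = (THE w. f w \<noteq> 0 \<and> (\<forall>v. ord v w \<longrightarrow> f v = 0))"

definition is_solution :: "('v::finite, 'a::comm_ring_1) dop set \<Rightarrow> ('v, 'a) ser \<Rightarrow> bool" where
  "is_solution G f \<longleftrightarrow> (\<forall>P\<in>G. dapply P f = (\<lambda>_. 0))"

definition lin_indep_ser :: "('v, 'a::comm_ring_1) ser set \<Rightarrow> bool" where
  "lin_indep_ser S \<longleftrightarrow> (\<forall>c. (\<lambda>w. \<Sum>f\<in>S. c f * f w) = (\<lambda>_. 0) \<longrightarrow> (\<forall>f\<in>S. c f = 0))"

end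

theory Submission
  imports Defs "HOL-Computational_Algebra.Polynomial" "HOL-Library.Function_Algebras" "HOL-Library.FuncSet"
begin

text \<open>
  The origin is ordinary iff no head coefficient vanishes there; this uses that lcms of polynomials exist,
  that is, Gauss's theorem on factorial polynomial rings.

  If all head coefficients are units at the origin, every \<open>\<partial>\<^sup>w\<close> can be reduced modulo \<open>G\<close> to a remainder
  \<open>\<Sum>u. r w u \<partial>\<^sup>u\<close> over the parametric terms \<open>u \<preceq> w\<close>, with rational coefficients regular at the origin.
  For a parametric exponent \<open>a\<close>, the series with coefficients \<open>r w a (0) / w!\<close> is a solution with initial
  exponent \<open>a\<close>: the Taylor coefficients of \<open>P f\<close> are read off from the normal forms of \<open>\<partial>\<^sup>v P\<close>, which
  vanish because a nonzero element of the ideal cannot be supported on parametric terms.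

  Conversely, let \<open>P \<in> G\<close> have head coefficient \<open>h\<close>. The matrix of derivatives of the solutions by the
  parametric terms has a triangular invertible constant term, so the equations \<open>P f = 0\<close> show that \<open>h\<close> divides
  every coefficient of \<open>P\<close> as a power series. If \<open>h\<close> vanished at the origin, so would a prime factor of \<open>h\<close>;
  a comparison of Hilbert functions shows that this prime divides all coefficients of \<open>P\<close> already as a
  polynomial, which contradicts primitivity.
\<close>

section \<open>Factorial subrings and Gauss's theorem\<close>

text \<open>Two obstacles shape the development. Divisibility by \<open>h\<close> is first obtained
  in K[[x]], where every series with nonzero constant term is a unit: a factor of \<open>h\<close>
  such as 1 + x is invisible there, so \<open>h\<close> need not divide the coefficients of
  \<open>P\<close> as a polynomial. A prime factor vanishing at the origin cannot hide in this way.
  The usual way back to polynomials is faithful flatness of the completion of the local ring at the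
  origin; the dimension count replaces it and rests on the number of monomials of degree j growing
  only polynomially in j. Factoriality, on the other hand, is proved by induction over the set of
  variables, while all series share one type. Hence it is a property of a subset of a ring rather
  than of a type, and pseudo-division takes the place of the fraction field. Rational functions
  regular at the origin are likewise a subset of K[[x]], so that evaluation at the origin is taking
  the constant term and no quotient field has to be built.\<close>

definition subring_set :: "'r::comm_ring_1 set \<Rightarrow> bool" where
  "subring_set R \<longleftrightarrow> 0 \<in> R \<and> 1 \<in> R \<and> (\<forall>a\<in>R. \<forall>b\<in>R. a + b \<in> R \<and> a - b \<in> R \<and> a * b \<in> R)"

definition dvd_in :: "'r::comm_ring_1 set \<Rightarrow> 'r \<Rightarrow> 'r \<Rightarrow> bool" where
  "dvd_in R a b \<longleftrightarrow> (\<exists>k\<in>R. b = a * k)"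

definition prime_in :: "'r::comm_ring_1 set \<Rightarrow> 'r \<Rightarrow> bool" where
  "prime_in R p \<longleftrightarrow> p \<in> R \<and> p \<noteq> 0 \<and> \<not> dvd_in R p 1 \<and>
     (\<forall>a\<in>R. \<forall>b\<in>R. dvd_in R p (a * b) \<longrightarrow> dvd_in R p a \<or> dvd_in R p b)"

text \<open>Existence of a factorization into primes, as opposed to irreducibles, already entails
  its uniqueness. The induction rule strips off one prime at a time and drives the arguments about
  cancellation, contents and lcms.\<close>

inductive prime_product :: "'r::comm_ring_1 set \<Rightarrow> 'r \<Rightarrow> bool" for R where
  unit: "a \<in> R \<Longrightarrow> dvd_in R a 1 \<Longrightarrow> prime_product R a"
| mult: "prime_in R p \<Longrightarrow> prime_product R a \<Longrightarrow> prime_product R (p * a)"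

definition factorial_in :: "'r::comm_ring_1 set \<Rightarrow> bool" where
  "factorial_in R \<longleftrightarrow> subring_set R \<and> (\<forall>a\<in>R. a \<noteq> 0 \<longrightarrow> prime_product R a)"

definition poly_over :: "'r::comm_ring_1 set \<Rightarrow> 'r poly set" where
  "poly_over R = {f. \<forall>i. coeff f i \<in> R}"

lemma subring_setD:
  assumes "subring_set R"
  shows "0 \<in> R" "1 \<in> R" "a \<in> R \<Longrightarrow> b \<in> R \<Longrightarrow> a + b \<in> R"
    "a \<in> R \<Longrightarrow> b \<in> R \<Longrightarrow> a - b \<in> R" "a \<in> R \<Longrightarrow> b \<in> R \<Longrightarrow> a * b \<in> R"
  using assms unfolding subring_set_def by auto

lemma subring_set_uminus: "subring_set R \<Longrightarrow> a \<in> R \<Longrightarrow> - a \<in> R"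
  using subring_setD(4)[of R 0 a] subring_setD(1)[of R] by simp

lemma subring_set_sum: "subring_set R \<Longrightarrow> (\<And>i. i \<in> I \<Longrightarrow> f i \<in> R) \<Longrightarrow> sum f I \<in> R"
  by (induction I rule: infinite_finite_induct) (auto intro: subring_setD)

lemma subring_set_prod: "subring_set R \<Longrightarrow> (\<And>i. i \<in> I \<Longrightarrow> f i \<in> R) \<Longrightarrow> prod f I \<in> R"
  by (induction I rule: infinite_finite_induct) (auto intro: subring_setD)

lemma subring_set_power: "subring_set R \<Longrightarrow> a \<in> R \<Longrightarrow> a ^ n \<in> R"
  by (induction n) (auto intro: subring_setD)

lemma dvd_in_mult_left: "subring_set R \<Longrightarrow> c \<in> R \<Longrightarrow> dvd_in R a b \<Longrightarrow> dvd_in R a (c * b)"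
  unfolding dvd_in_def by (metis mult.left_commute subring_setD(5))

lemma dvd_in_mult_right: "subring_set R \<Longrightarrow> c \<in> R \<Longrightarrow> dvd_in R a b \<Longrightarrow> dvd_in R a (b * c)"
  by (metis mult.commute dvd_in_mult_left)

lemma dvd_in_refl: "subring_set R \<Longrightarrow> dvd_in R a a"
  unfolding dvd_in_def by (metis mult.right_neutral subring_setD(2))

lemma dvd_in_trans: "subring_set R \<Longrightarrow> dvd_in R a b \<Longrightarrow> dvd_in R b c \<Longrightarrow> dvd_in R a c"
  unfolding dvd_in_def by (metis mult.assoc subring_setD(5))

lemma dvd_in_diff:
  "subring_set R \<Longrightarrow> dvd_in R a b \<Longrightarrow> dvd_in R a c \<Longrightarrow> dvd_in R a (b - c)"
  unfolding dvd_in_def by (metis right_diff_distrib subring_setD(4))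

lemma prime_product_in:
  assumes "subring_set R" "prime_product R a"
  shows "a \<in> R"
  using assms(2) by induction (auto simp: prime_in_def intro: subring_setD[OF assms(1)])

lemma prime_product_times:
  fixes a b :: "'r::idom"
  assumes R: "subring_set R" and "prime_product R a" and b: "prime_product R b"
  shows "prime_product R (a * b)"
  using assms(2)
proof (induction rule: prime_product.induct)
  case (unit a)
  from b unit show ?case
  proof (induction arbitrary: a rule: prime_product.induct)
    case (unit b)
    then obtain k l where "k \<in> R" "l \<in> R" "1 = a * k" "1 = b * l" by (auto simp: dvd_in_def)
    then have "k * l \<in> R" "1 = (a * b) * (k * l)"
      using R by (auto intro: subring_setD, metis mult.assoc mult.left_commute mult_1_right)
    then show ?case using unit R
      by (intro prime_product.unit) (auto simp: dvd_in_def intro: subring_setD)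
  next
    case (mult p c)
    then show ?case using prime_product.mult[of R p "a * c"] by (simp add: mult.left_commute)
  qed
next
  case (mult p a)
  then show ?case using prime_product.mult[of R p "a * b"] by (simp add: mult.assoc)
qed

lemma prime_product_of_prime: "subring_set R \<Longrightarrow> prime_in R p \<Longrightarrow> prime_product R p"
  using prime_product.mult[OF _ prime_product.unit[of 1 R], of p]
  by (auto intro: subring_setD dvd_in_refl)

lemma subring_set_poly_over: "subring_set R \<Longrightarrow> subring_set (poly_over R)"
  unfolding poly_over_def
  by (subst subring_set_def) (auto simp: coeff_mult coeff_1 coeff_0 intro!: subring_setD subring_set_sum)

lemma const_in_poly_over: "subring_set R \<Longrightarrow> c \<in> R \<Longrightarrow> [:c:] \<in> poly_over R"
  unfolding poly_over_def by (auto simp: coeff_pCons split: nat.splits intro: subring_setD)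

lemma monom_in_poly_over: "subring_set R \<Longrightarrow> c \<in> R \<Longrightarrow> monom c i \<in> poly_over R"
  unfolding poly_over_def by (auto intro: subring_setD)

section \<open>Contents, Gauss's lemma and primes of positive degree\<close>

lemma dvd_in_const_poly_iff:
  fixes c :: "'r::idom"
  assumes R: "subring_set R" and f: "f \<in> poly_over R"
  shows "dvd_in (poly_over R) [:c:] f \<longleftrightarrow> (\<forall>i. dvd_in R c (coeff f i))"
proof
  assume "dvd_in (poly_over R) [:c:] f"
  then show "\<forall>i. dvd_in R c (coeff f i)"
    unfolding dvd_in_def poly_over_def by auto
next
  assume "\<forall>i. dvd_in R c (coeff f i)"
  then obtain k where k: "\<And>i. k i \<in> R" "\<And>i. coeff f i = c * k i"
    unfolding dvd_in_def by metis
  define g where "g = (\<Sum>i\<le>degree f. monom (k i) i)"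
  have "g \<in> poly_over R" unfolding g_def
    using R k by (intro subring_set_sum subring_set_poly_over monom_in_poly_over)
  moreover have "f = [:c:] * g"
  proof (rule poly_eqI)
    fix i
    have "coeff g i = (if i \<le> degree f then k i else 0)"
      unfolding g_def by (simp add: coeff_sum)
    then show "coeff f i = coeff ([:c:] * g) i"
      using k(2)[of i] coeff_eq_0[of f i] by auto
  qed
  ultimately show "dvd_in (poly_over R) [:c:] f" unfolding dvd_in_def by blast
qed

text \<open>Gauss's lemma: if \<open>i\<close> and \<open>j\<close> are the first indices where
  \<open>p\<close> fails to divide a coefficient of \<open>a\<close> and of \<open>b\<close>, then
  in the coefficient of \<open>a * b\<close> at \<open>i + j\<close> all summands but one are
  divisible by \<open>p\<close>.\<close>

lemma prime_in_const_poly: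
  fixes p :: "'r::idom"
  assumes R: "subring_set R" and p: "prime_in R p"
  shows "prime_in (poly_over R) [:p:]"
  unfolding prime_in_def
proof (intro conjI ballI impI)
  note RX = subring_set_poly_over[OF R]
  show "[:p:] \<in> poly_over R" "[:p:] \<noteq> 0"
    using p R by (auto simp: prime_in_def intro: const_in_poly_over)
  show "\<not> dvd_in (poly_over R) [:p:] 1"
  proof
    assume "dvd_in (poly_over R) [:p:] 1"
    then have "dvd_in R p (coeff 1 0)"
      using dvd_in_const_poly_iff[OF R subring_setD(2)[OF RX]] by blast
    then show False using p by (simp add: prime_in_def)
  qed
next
  note RX = subring_set_poly_over[OF R]
  fix a b assume a: "a \<in> poly_over R" and b: "b \<in> poly_over R"
    and d: "dvd_in (poly_over R) [:p:] (a * b)"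
  show "dvd_in (poly_over R) [:p:] a \<or> dvd_in (poly_over R) [:p:] b"
  proof (rule ccontr)
    assume "\<not> ?thesis"
    then have ex: "\<exists>i. \<not> dvd_in R p (coeff a i)" "\<exists>j. \<not> dvd_in R p (coeff b j)"
      using dvd_in_const_poly_iff[OF R] a b by blast+
    define i where "i = (LEAST i. \<not> dvd_in R p (coeff a i))"
    define j where "j = (LEAST j. \<not> dvd_in R p (coeff b j))"
    have i: "\<not> dvd_in R p (coeff a i)" "\<And>k. k < i \<Longrightarrow> dvd_in R p (coeff a k)"
      unfolding i_def using LeastI_ex[OF ex(1)] not_less_Least by blast+
    have j: "\<not> dvd_in R p (coeff b j)" "\<And>k. k < j \<Longrightarrow> dvd_in R p (coeff b k)"
      unfolding j_def using LeastI_ex[OF ex(2)] not_less_Least by blast+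
    have ca: "coeff a k \<in> R" "coeff b k \<in> R" for k using a b by (auto simp: poly_over_def)
    have "dvd_in R p (coeff (a * b) (i + j))"
      using d dvd_in_const_poly_iff[OF R] subring_setD(5)[OF RX a b] by blast
    moreover have "coeff (a * b) (i + j) =
        coeff a i * coeff b j + (\<Sum>k\<in>{..i+j}-{i}. coeff a k * coeff b (i + j - k))"
      unfolding coeff_mult by (subst sum.remove[of _ i]) auto
    moreover have "dvd_in R p (\<Sum>k\<in>{..i+j}-{i}. coeff a k * coeff b (i + j - k))"
    proof -
      have "dvd_in R p (coeff a k * coeff b (i + j - k))" if "k \<in> {..i+j}-{i}" for k
      proof (cases "k < i")
        case True
        then show ?thesis using i(2) ca R by (blast intro: dvd_in_mult_right)
      next
        case False
        then have "i + j - k < j" using that by auto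
        then show ?thesis using j(2) ca R by (blast intro: dvd_in_mult_left)
      qed
      then obtain l where "\<And>k. k \<in> {..i+j}-{i} \<Longrightarrow>
          l k \<in> R \<and> coeff a k * coeff b (i + j - k) = p * l k"
        unfolding dvd_in_def by metis
      then have "(\<Sum>k\<in>{..i+j}-{i}. coeff a k * coeff b (i + j - k)) = p * sum l ({..i+j}-{i})"
        "sum l ({..i+j}-{i}) \<in> R"
        using R by (auto simp: sum_distrib_left intro!: sum.cong subring_set_sum)
      then show ?thesis unfolding dvd_in_def by blast
    qed
    ultimately have "dvd_in R p (coeff a i * coeff b j)"
      using dvd_in_diff[OF R, of p "coeff (a * b) (i + j)"
          "\<Sum>k\<in>{..i+j}-{i}. coeff a k * coeff b (i + j - k)"] by simp
    then show False using p i(1) j(1) ca by (auto simp: prime_in_def)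
  qed
qed

text \<open>A power of the leading coefficient clears the denominators that division over the
  fraction field would create, so quotient and remainder stay over \<open>R\<close>.\<close>

lemma pseudo_division_over:
  fixes g :: "'r::idom poly"
  assumes R: "subring_set R" and g: "g \<in> poly_over R" "g \<noteq> 0" and f: "f \<in> poly_over R"
  shows "\<exists>m q r. q \<in> poly_over R \<and> r \<in> poly_over R \<and>
    [:lead_coeff g ^ m:] * f = q * g + r \<and> (r = 0 \<or> degree r < degree g)"
  using f
proof (induction "degree f" arbitrary: f rule: less_induct)
  case less
  note RX = subring_set_poly_over[OF R]
  show ?case
  proof (cases "f = 0 \<or> degree f < degree g")
    case True
    then show ?thesis using less.prems RX
      by (intro exI[of _ 0] exI[of _ 0] exI[of _ f]) (auto intro: subring_setD)
  next
    case False
    define t where "t = monom (lead_coeff f) (degree f - degree g)"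
    define f' where "f' = [:lead_coeff g:] * f - t * g"
    have lc: "lead_coeff g \<in> R" "lead_coeff f \<in> R" using g less.prems by (auto simp: poly_over_def)
    have t: "t \<in> poly_over R" unfolding t_def using lc R by (intro monom_in_poly_over)
    have f': "f' \<in> poly_over R" unfolding f'_def
      using RX t g less.prems lc R by (intro subring_setD const_in_poly_over) auto
    have le: "degree f' \<le> degree f"
    proof -
      have "degree (t * g) \<le> degree f"
        using degree_mult_le[of t g] degree_monom_le[of "lead_coeff f" "degree f - degree g"] False
        unfolding t_def by linarith
      moreover have "degree ([:lead_coeff g:] * f) \<le> degree f"
        using degree_mult_le[of "[:lead_coeff g:]" f] by simp
      ultimately show ?thesis unfolding f'_def by (rule degree_diff_le[rotated])
    qed
    have "coeff f' (degree f) = 0"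
      unfolding f'_def t_def using False by (simp add: coeff_monom_mult)
    then have lt: "f' = 0 \<or> degree f' < degree f"
      using le by (metis le_neq_implies_less leading_coeff_0_iff)
    obtain m q r where qr: "q \<in> poly_over R" "r \<in> poly_over R"
      "[:lead_coeff g ^ m:] * f' = q * g + r" "r = 0 \<or> degree r < degree g"
    proof (cases "f' = 0")
      case True
      then show ?thesis using that[of 0 0 0] subring_setD(1)[OF RX] by auto
    next
      case False
      then show ?thesis using less.hyps[OF _ f'] lt that by blast
    qed
    have "[:lead_coeff g ^ Suc m:] * f = [:lead_coeff g ^ m:] * (f' + t * g)"
      unfolding f'_def by (simp add: mult.commute)
    also have "\<dots> = (q + [:lead_coeff g ^ m:] * t) * g + r"
      unfolding distrib_left qr(3) by (simp add: algebra_simps del: mult_pCons_left mult_pCons_right)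
    finally show ?thesis
      using qr t lc R RX
      by (intro exI[of _ "Suc m"] exI[of _ "q + [:lead_coeff g ^ m:] * t"] exI[of _ r] conjI)
        (auto intro!: subring_setD(3,5)[OF RX] const_in_poly_over subring_set_power simp del: mult_pCons_left)
  qed
qed

text \<open>Each prime factor of \<open>c\<close> remains prime as a constant polynomial, hence
  divides \<open>q\<close> or \<open>h\<close> and can be cancelled there; \<open>k\<close> collects
  those taken from \<open>h\<close>. This turns a factorization over the fraction field into one
  over \<open>R\<close> with the same degrees.\<close>

lemma split_off_constant_factor:
  fixes c :: "'r::idom"
  assumes R: "subring_set R" and c: "prime_product R c"
    and "f \<in> poly_over R" "q \<in> poly_over R" "h \<in> poly_over R" "f \<noteq> 0"
    and "[:c:] * f = q * h"
  shows "\<exists>q'\<in>poly_over R. \<exists>h'\<in>poly_over R. \<exists>k\<in>R. f = q' * h' \<and> h = [:k:] * h' \<and>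
    degree q' = degree q \<and> degree h' = degree h"
  using c assms(3-)
proof (induction arbitrary: q h rule: prime_product.induct)
  case (unit c)
  note RX = subring_set_poly_over[OF R]
  obtain k where k: "k \<in> R" "1 = c * k" using unit by (auto simp: dvd_in_def)
  have "f = [:k:] * ([:c:] * f)" using k(2) by (simp add: mult.commute one_pCons[symmetric])
  then have "f = ([:k:] * q) * h" using unit by (metis mult.assoc)
  moreover have "[:k:] * q \<in> poly_over R"
    using k unit RX R by (intro subring_setD const_in_poly_over)
  moreover have "degree ([:k:] * q) = degree q" using k by auto
  moreover have "h = [:1:] * h" by simp
  ultimately show ?case using unit subring_setD(2)[OF R] by blast
next
  case (mult p c)
  note RX = subring_set_poly_over[OF R]
  have pR: "p \<in> R" "p \<noteq> 0" using mult by (auto simp: prime_in_def)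
  have cR: "c \<in> R" using mult prime_product_in[OF R] by blast
  have eq: "[:p:] * ([:c:] * f) = q * h" using mult.prems by (simp add: mult.commute[of p c])
  then have "dvd_in (poly_over R) [:p:] (q * h)"
    unfolding dvd_in_def using subring_setD(5)[OF RX const_in_poly_over[OF R cR] mult.prems(1)]
    by metis
  then have "dvd_in (poly_over R) [:p:] q \<or> dvd_in (poly_over R) [:p:] h"
    using prime_in_const_poly[OF R mult.hyps(1)] mult.prems by (auto simp: prime_in_def)
  then show ?case
  proof
    assume "dvd_in (poly_over R) [:p:] q"
    then obtain q1 where q1: "q1 \<in> poly_over R" "q = [:p:] * q1" by (auto simp: dvd_in_def)
    have "[:p:] * ([:c:] * f) = [:p:] * (q1 * h)" using eq q1 by (simp add: mult.assoc)
    then have "[:c:] * f = q1 * h" using pR by (metis mult_left_cancel pCons_eq_0_iff)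
    then obtain q' h' k where "q'\<in>poly_over R" "h'\<in>poly_over R" "k\<in>R" "f = q' * h'" "h = [:k:] * h'"
      "degree q' = degree q1" "degree h' = degree h"
      using mult.IH[OF mult.prems(1) q1(1) mult.prems(3,4)] by blast
    moreover have "degree q1 = degree q" using q1 pR by auto
    ultimately show ?thesis by metis
  next
    assume "dvd_in (poly_over R) [:p:] h"
    then obtain h1 where h1: "h1 \<in> poly_over R" "h = [:p:] * h1" by (auto simp: dvd_in_def)
    have "[:p:] * ([:c:] * f) = [:p:] * (q * h1)" using eq h1 by (simp add: ac_simps)
    then have "[:c:] * f = q * h1" using pR by (metis mult_left_cancel pCons_eq_0_iff)
    then obtain q' h' k where *: "q'\<in>poly_over R" "h'\<in>poly_over R" "k\<in>R" "f = q' * h'" "h1 = [:k:] * h'"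
      "degree q' = degree q" "degree h' = degree h1"
      using mult.IH[OF mult.prems(1,2) h1(1) mult.prems(4)] by blast
    moreover have "degree h1 = degree h" using h1 pR by auto
    moreover have "h = [:p * k:] * h'" using h1 * by (simp add: mult.commute[of p k])
    moreover have "p * k \<in> R" using pR * subring_setD(5)[OF R] by blast
    ultimately show ?thesis by metis
  qed
qed

text \<open>A prime factor of \<open>c\<close> divides \<open>f\<close> times the cofactor but not
  \<open>f\<close>, so it divides the cofactor and cancels.\<close>

lemma dvd_in_cancel_constant:
  fixes c :: "'r::idom"
  assumes R: "subring_set R" and c: "prime_product R c"
    and f: "f \<in> poly_over R" and prim: "\<And>p. prime_in R p \<Longrightarrow> \<not> dvd_in (poly_over R) [:p:] f"
    and "b \<in> poly_over R" "dvd_in (poly_over R) f ([:c:] * b)"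
  shows "dvd_in (poly_over R) f b"
  using c assms(5-)
proof (induction arbitrary: b rule: prime_product.induct)
  case (unit c)
  note RX = subring_set_poly_over[OF R]
  obtain k where k: "k \<in> R" "1 = c * k" using unit by (auto simp: dvd_in_def)
  have "b = [:k:] * ([:c:] * b)" using k(2) by (simp add: mult.commute one_pCons[symmetric])
  then show ?case using unit dvd_in_mult_left[OF RX const_in_poly_over[OF R k(1)]] by metis
next
  case (mult p c)
  note RX = subring_set_poly_over[OF R]
  have pR: "p \<noteq> 0" using mult by (auto simp: prime_in_def)
  have cR: "c \<in> R" using mult prime_product_in[OF R] by blast
  obtain k where k: "k \<in> poly_over R" "[:p:] * ([:c:] * b) = f * k"
    using mult.prems by (auto simp: dvd_in_def mult.commute[of p c])
  have cb: "[:c:] * b \<in> poly_over R"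
    using mult.prems cR R RX by (intro subring_setD const_in_poly_over)
  have "dvd_in (poly_over R) [:p:] (f * k)" using k cb unfolding dvd_in_def by metis
  then have "dvd_in (poly_over R) [:p:] k"
    using prime_in_const_poly[OF R mult.hyps(1)] prim[OF mult.hyps(1)] f k(1)
    by (auto simp: prime_in_def)
  then obtain k1 where k1: "k1 \<in> poly_over R" "k = [:p:] * k1" by (auto simp: dvd_in_def)
  have "[:p:] * ([:c:] * b) = [:p:] * (f * k1)" using k(2) k1 by (simp add: ac_simps)
  then have "[:c:] * b = f * k1" using pR by (metis mult_left_cancel pCons_eq_0_iff)
  then show ?case using mult.IH mult.prems(1) k1(1) unfolding dvd_in_def by blast
qed

lemma primitive_indecomposable_prime_in:
  fixes f :: "'r::idom poly"
  assumes R: "factorial_in R" and f: "f \<in> poly_over R" and deg: "degree f > 0"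
    and prim: "\<And>p. prime_in R p \<Longrightarrow> \<not> dvd_in (poly_over R) [:p:] f"
    and indec: "\<And>g h. g \<in> poly_over R \<Longrightarrow> h \<in> poly_over R \<Longrightarrow> f = g * h \<Longrightarrow>
      degree g = 0 \<or> degree h = 0"
  shows "prime_in (poly_over R) f"
proof -
  have SR: "subring_set R" using R by (simp add: factorial_in_def)
  note RX = subring_set_poly_over[OF SR]
  have f0: "f \<noteq> 0" using deg by auto
  have ppow: "prime_product R (lead_coeff g ^ m)" if "g \<in> poly_over R" "g \<noteq> 0" for g m
    using that R subring_set_power[OF SR, of "lead_coeff g" m]
    by (auto simp: factorial_in_def poly_over_def)
  have main: "dvd_in (poly_over R) f a"
    if a: "a \<in> poly_over R" and b: "b \<in> poly_over R" and ab: "dvd_in (poly_over R) f (a * b)"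
      and nb: "\<not> dvd_in (poly_over R) f b" for a b
  proof -
    \<comment> \<open>The Euclidean argument of a principal ideal domain, carried out with
      pseudo-division: an element of least degree in this ideal divides every other one up to a
      constant.\<close>
    define I where "I = {h \<in> poly_over R. dvd_in (poly_over R) f (h * b)}"
    have I_mult: "k * h \<in> I" if "k \<in> poly_over R" "h \<in> I" for k h
      using that RX by (auto simp: I_def mult.assoc intro: subring_setD dvd_in_mult_left)
    have I_diff: "h - k \<in> I" if "h \<in> I" "k \<in> I" for h k
      using that RX by (auto simp: I_def left_diff_distrib intro: subring_setD dvd_in_diff)
    have fI: "f \<in> I" using f b RX by (auto simp: I_def intro: dvd_in_mult_right dvd_in_refl)
    have aI: "a \<in> I" using a ab by (auto simp: I_def)
    obtain h where h: "h \<in> I" "h \<noteq> 0" and min: "\<And>k. k \<in> I \<Longrightarrow> k \<noteq> 0 \<Longrightarrow> degree h \<le> degree k"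
      using ex_has_least_nat[of "\<lambda>h. h \<in> I \<and> h \<noteq> 0" f degree] fI f0 by blast
    have hR: "h \<in> poly_over R" using h by (simp add: I_def)
    \<comment> \<open>Formulated for any element of least degree, because it is applied to
      \<open>h\<close> and then, once the degrees are seen to agree, to \<open>f\<close>
      itself.\<close>
    have rem: "\<exists>m q. q \<in> poly_over R \<and> [:lead_coeff g ^ m:] * k = q * g"
      if g: "g \<in> I" "g \<noteq> 0" "degree g = degree h" and k: "k \<in> I" for g k
    proof -
      have gR: "g \<in> poly_over R" and kR: "k \<in> poly_over R" using g k by (auto simp: I_def)
      from pseudo_division_over[OF SR gR g(2) kR] obtain m q r where
        qr: "q \<in> poly_over R" "r \<in> poly_over R" "[:lead_coeff g ^ m:] * k = q * g + r"
          "r = 0 \<or> degree r < degree g" by blast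
      have "lead_coeff g ^ m \<in> R" using gR subring_set_power[OF SR] by (auto simp: poly_over_def)
      then have "[:lead_coeff g ^ m:] * k - q * g \<in> I"
        using I_diff I_mult const_in_poly_over[OF SR] k g qr by blast
      then have "r \<in> I" using qr(3) by (metis add_diff_cancel_left')
      then have "r = 0" using min[of r] qr(4) g(3) by (metis not_le)
      then show ?thesis using qr by auto
    qed
    obtain m q where mq: "q \<in> poly_over R" "[:lead_coeff h ^ m:] * f = q * h"
      using rem[OF h refl fI] by blast
    obtain q' h' k where qhk: "q' \<in> poly_over R" "h' \<in> poly_over R" "k \<in> R" "f = q' * h'"
      "h = [:k:] * h'" "degree h' = degree h"
      using split_off_constant_factor[OF SR ppow[OF hR h(2)] f mq(1) hR f0 mq(2)] by blast
    \<comment> \<open>A constant in the ideal could be cancelled and would give \<open>f\<close>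
      dividing \<open>b\<close>. So the part of \<open>f\<close> coming from \<open>h\<close> has
      positive degree, and indecomposability leaves no degree for the cofactor.\<close>
    have "degree h \<noteq> 0"
    proof
      assume "degree h = 0"
      then obtain c where c: "h = [:c:]" by (metis degree_eq_zeroE)
      then have "c \<in> R" "c \<noteq> 0" using hR h by (auto simp: poly_over_def coeff_pCons split: nat.splits dest: spec[of _ 0])
      then have "prime_product R c" using R by (auto simp: factorial_in_def)
      moreover have "dvd_in (poly_over R) f ([:c:] * b)" using h c by (simp add: I_def)
      ultimately show False using dvd_in_cancel_constant[OF SR _ f prim b] nb by blast
    qed
    then have "degree q' = 0" using indec[OF qhk(1,2,4)] qhk(6) by auto
    then have "degree f = degree h"
      using qhk(4,6) f0 degree_mult_eq[of q' h'] by auto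
    then obtain m q where "q \<in> poly_over R" "[:lead_coeff f ^ m:] * a = q * f"
      using rem[OF fI f0 _ aI] by auto
    then have "dvd_in (poly_over R) f ([:lead_coeff f ^ m:] * a)"
      unfolding dvd_in_def by (metis mult.commute)
    then show ?thesis using dvd_in_cancel_constant[OF SR ppow[OF f f0] f prim a] by blast
  qed
  have "\<not> dvd_in (poly_over R) f 1"
  proof
    assume "dvd_in (poly_over R) f 1"
    then obtain k where k: "1 = f * k" by (auto simp: dvd_in_def)
    then have "degree (f * k) = 0" "k \<noteq> 0" by (metis degree_1, auto)
    then show False using deg f0 degree_mult_eq[of f k] by auto
  qed
  then show ?thesis unfolding prime_in_def using f f0 main by blast
qed

lemma prime_product_const_poly:
  fixes c :: "'r::idom"
  assumes R: "subring_set R" and "prime_product R c"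
  shows "prime_product (poly_over R) [:c:]"
  using assms(2)
proof (induction rule: prime_product.induct)
  case (unit c)
  then obtain k where "k \<in> R" "1 = c * k" by (auto simp: dvd_in_def)
  then have "[:k:] \<in> poly_over R" "1 = [:c:] * [:k:]"
    using R by (auto simp: one_pCons mult.commute intro: const_in_poly_over)
  then show ?case using unit R const_in_poly_over
    by (intro prime_product.unit) (auto simp only: dvd_in_def)
next
  case (mult p c)
  then show ?case
    using prime_product.mult[OF prime_in_const_poly[OF R mult(1)] mult.IH] by (simp add: mult.commute[of p c])
qed

text \<open>Here \<open>c\<close> bounds the constants dividing \<open>f\<close>, which makes the
  extraction of primes terminate. If \<open>p\<close> divides \<open>f\<close>, it is split off
  both; otherwise no constant divisor of \<open>f\<close> is a multiple of \<open>p\<close>, so all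
  of them divide the bound without \<open>p\<close>. The leading coefficient serves as the initial
  bound.\<close>

lemma content_decomposition:
  fixes f :: "'r::idom poly"
  assumes R: "subring_set R" and c: "prime_product R c" and "f \<in> poly_over R"
    and "\<And>d. d \<in> R \<Longrightarrow> dvd_in (poly_over R) [:d:] f \<Longrightarrow> dvd_in R d c"
  shows "\<exists>e g. prime_product R e \<and> g \<in> poly_over R \<and> f = [:e:] * g \<and>
    (\<forall>p. prime_in R p \<longrightarrow> \<not> dvd_in (poly_over R) [:p:] g)"
  using c assms(3,4)
proof (induction arbitrary: f rule: prime_product.induct)
  case (unit c)
  have "\<not> dvd_in (poly_over R) [:p:] f" if "prime_in R p" for p
    using that unit dvd_in_trans[OF R, of p c 1] by (auto simp: prime_in_def)
  moreover have "prime_product R 1"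
    by (rule prime_product.unit) (auto intro: subring_setD dvd_in_refl R)
  moreover have "f = [:1:] * f" by simp
  ultimately show ?case using unit.prems by blast
next
  case (mult p c)
  note RX = subring_set_poly_over[OF R]
  have pR: "p \<in> R" "p \<noteq> 0" using mult by (auto simp: prime_in_def)
  have cR: "c \<in> R" using mult prime_product_in[OF R] by blast
  show ?case
  proof (cases "dvd_in (poly_over R) [:p:] f")
    case True
    then obtain g where g: "g \<in> poly_over R" "f = [:p:] * g" by (auto simp: dvd_in_def)
    have "dvd_in R d c" if d: "d \<in> R" "dvd_in (poly_over R) [:d:] g" for d
    proof -
      have "dvd_in (poly_over R) [:p * d:] f"
        using d(2) g unfolding dvd_in_def by auto
      then have "dvd_in R (p * d) (p * c)"
        using mult.prems(2) d subring_setD(5)[OF R pR(1)] by blast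
      then show ?thesis using pR unfolding dvd_in_def by (auto simp: mult.assoc)
    qed
    then obtain e h where eh: "prime_product R e" "h \<in> poly_over R" "g = [:e:] * h"
      "\<forall>p. prime_in R p \<longrightarrow> \<not> dvd_in (poly_over R) [:p:] h"
      using mult.IH[OF g(1)] by blast
    have "f = [:p * e:] * h" using g eh by (simp add: mult.commute[of p e])
    then show ?thesis using eh prime_product.mult[OF mult.hyps(1) eh(1)] by blast
  next
    case False
    have "dvd_in R d c" if d: "d \<in> R" "dvd_in (poly_over R) [:d:] f" for d
    proof -
      obtain k where k: "k \<in> R" "p * c = d * k"
        using mult.prems(2)[OF d] by (auto simp: dvd_in_def)
      then have "dvd_in R p (d * k)" using cR unfolding dvd_in_def by metis
      moreover have "\<not> dvd_in R p d"
      proof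
        assume "dvd_in R p d"
        then obtain l where "l \<in> R" "d = p * l" by (auto simp: dvd_in_def)
        then have "dvd_in (poly_over R) [:p:] [:d:]"
          unfolding dvd_in_def using const_in_poly_over[OF R] by (intro bexI[of _ "[:l:]"]) auto
        then show False using False d(2) dvd_in_trans[OF RX] by blast
      qed
      ultimately have "dvd_in R p k" using mult.hyps(1) d k by (auto simp: prime_in_def)
      then obtain l where "l \<in> R" "k = p * l" by (auto simp: dvd_in_def)
      then have "p * c = p * (d * l)" using k by (simp add: ac_simps)
      then show ?thesis using pR \<open>l \<in> R\<close> unfolding dvd_in_def by auto
    qed
    then show ?thesis using mult.IH[OF mult.prems(1)] by blast
  qed
qed

text \<open>Once the content is removed, a polynomial is a constant, a product of two factors of
  smaller degree, or a prime by \<open>primitive_indecomposable_prime_in\<close>.\<close>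

lemma factorial_in_poly_over:
  fixes R :: "'r::idom set"
  assumes R: "factorial_in R"
  shows "factorial_in (poly_over R)"
proof -
  have SR: "subring_set R" using R by (simp add: factorial_in_def)
  note RX = subring_set_poly_over[OF SR]
  have "prime_product (poly_over R) f" if "f \<in> poly_over R" "f \<noteq> 0" for f
    using that
  proof (induction "degree f" arbitrary: f rule: less_induct)
    case less
    have lc: "lead_coeff f \<in> R" using less.prems by (auto simp: poly_over_def)
    then have "prime_product R (lead_coeff f)" using less.prems R by (auto simp: factorial_in_def)
    then obtain e g where eg: "prime_product R e" "g \<in> poly_over R" "f = [:e:] * g"
      and prim: "\<And>p. prime_in R p \<Longrightarrow> \<not> dvd_in (poly_over R) [:p:] g"
      using content_decomposition[OF SR _ less.prems(1)]
        dvd_in_const_poly_iff[OF SR less.prems(1)] by metis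
    have g0: "g \<noteq> 0" and e0: "e \<noteq> 0" using eg less.prems by auto
    have deg: "degree g = degree f" using eg e0 by simp
    have "prime_product (poly_over R) g"
    proof (cases "degree g = 0")
      case True
      then obtain c where c: "g = [:c:]" by (metis degree_eq_zeroE)
      then have "c \<in> R" "c \<noteq> 0"
        using eg g0 unfolding poly_over_def by (auto dest: spec[of _ 0])
      then show ?thesis using c R prime_product_const_poly[OF SR] by (auto simp: factorial_in_def)
    next
      case False
      show ?thesis
      proof (cases "\<exists>a\<in>poly_over R. \<exists>b\<in>poly_over R. g = a * b \<and> degree a \<noteq> 0 \<and> degree b \<noteq> 0")
        case True
        then obtain a b where ab: "a \<in> poly_over R" "b \<in> poly_over R" "g = a * b"
          "degree a \<noteq> 0" "degree b \<noteq> 0" by blast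
        then have "a \<noteq> 0" "b \<noteq> 0" by auto
        then have "degree a < degree f" "degree b < degree f"
          using ab deg degree_mult_eq[of a b] by auto
        then have "prime_product (poly_over R) a" "prime_product (poly_over R) b"
          using less.hyps ab \<open>a \<noteq> 0\<close> \<open>b \<noteq> 0\<close> by auto
        then show ?thesis using ab prime_product_times[OF RX] by simp
      next
        case nosplit: False
        have "prime_in (poly_over R) g"
          using False nosplit by (intro primitive_indecomposable_prime_in[OF R eg(2) _ prim]) auto
        then show ?thesis by (rule prime_product_of_prime[OF RX])
      qed
    qed
    then show ?case
      unfolding eg(3) by (intro prime_product_times RX prime_product_const_poly[OF SR] eg(1))
  qed
  then show ?thesis using RX by (simp add: factorial_in_def)
qed

text \<open>Intended for evaluation at a variable: a homomorphism on all polynomials, but injective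
  only where the coefficients do not contain that variable.\<close>

lemma factorial_in_image:
  fixes \<phi> :: "'r::idom \<Rightarrow> 's::idom"
  assumes R: "factorial_in R" and inj: "inj_on \<phi> R"
    and hom: "\<And>a b. \<phi> (a + b) = \<phi> a + \<phi> b" "\<And>a b. \<phi> (a - b) = \<phi> a - \<phi> b"
      "\<And>a b. \<phi> (a * b) = \<phi> a * \<phi> b" "\<phi> 0 = 0" "\<phi> 1 = 1"
  shows "factorial_in (\<phi> ` R)"
proof -
  have SR: "subring_set R" using R by (simp add: factorial_in_def)
  have S: "subring_set (\<phi> ` R)"
    unfolding subring_set_def
    using hom subring_setD[OF SR] by (auto simp: hom(1-3)[symmetric] intro: rev_image_eqI)
  have dvd: "dvd_in (\<phi> ` R) (\<phi> a) (\<phi> b) \<longleftrightarrow> dvd_in R a b" if "a \<in> R" "b \<in> R" for a b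
  proof -
    have "\<phi> b = \<phi> a * \<phi> k \<longleftrightarrow> b = a * k" if "k \<in> R" for k
      using inj_on_eq_iff[OF inj \<open>b \<in> R\<close> subring_setD(5)[OF SR \<open>a \<in> R\<close> that]] hom(3) by simp
    then show ?thesis unfolding dvd_in_def by auto
  qed
  have pr: "prime_in (\<phi> ` R) (\<phi> p)" if p: "prime_in R p" for p
  proof -
    have pR: "p \<in> R" and p0: "p \<noteq> 0" and pu: "\<not> dvd_in R p 1"
      and pm: "\<And>a b. a \<in> R \<Longrightarrow> b \<in> R \<Longrightarrow> dvd_in R p (a * b) \<Longrightarrow> dvd_in R p a \<or> dvd_in R p b"
      using p by (auto simp: prime_in_def)
    have "\<phi> p \<noteq> 0" using inj_on_eq_iff[OF inj pR subring_setD(1)[OF SR]] p0 hom(4) by simp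
    moreover have "\<not> dvd_in (\<phi> ` R) (\<phi> p) 1" using dvd[OF pR subring_setD(2)[OF SR]] pu hom(5) by simp
    moreover have "dvd_in (\<phi> ` R) (\<phi> p) (\<phi> a) \<or> dvd_in (\<phi> ` R) (\<phi> p) (\<phi> b)"
      if "a \<in> R" "b \<in> R" "dvd_in (\<phi> ` R) (\<phi> p) (\<phi> a * \<phi> b)" for a b
      using that pm[of a b] dvd[OF pR] subring_setD(5)[OF SR that(1,2)] hom(3) by metis
    ultimately show ?thesis unfolding prime_in_def using pR by blast
  qed
  have "prime_product (\<phi> ` R) (\<phi> a)" if "prime_product R a" for a
    using that
  proof induction
    case (unit a)
    then show ?case
      using dvd[of a 1] subring_setD(2)[OF SR] hom(5) by (intro prime_product.unit) auto
  next
    case (mult p a)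
    then show ?case using prime_product.mult[OF pr] hom(3) by metis
  qed
  then show ?thesis using R S hom(4) unfolding factorial_in_def by auto
qed

text \<open>Induction over the primes of the first argument. If \<open>p\<close> divides
  \<open>b\<close>, it is cancelled from both arguments; if not, a common multiple
  \<open>p * k = b * c\<close> forces \<open>p\<close> into \<open>c\<close>. In either case the new
  lcm is \<open>p\<close> times the one from the induction hypothesis.\<close>

lemma lcm_in_exists:
  fixes a b :: "'r::idom"
  assumes R: "subring_set R" and "prime_product R a" and "b \<in> R"
  shows "\<exists>l\<in>R. dvd_in R a l \<and> dvd_in R b l \<and> (\<forall>m\<in>R. dvd_in R a m \<longrightarrow> dvd_in R b m \<longrightarrow> dvd_in R l m)"
  using assms(2,3)
proof (induction arbitrary: b rule: prime_product.induct)
  case (unit a)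
  then have "dvd_in R a b" using dvd_in_mult_left[OF R, of b a 1] by simp
  then show ?case using unit dvd_in_refl[OF R] by blast
next
  case (mult p a)
  have pR: "p \<in> R" "p \<noteq> 0" using mult by (auto simp: prime_in_def)
  have aR: "a \<in> R" using mult prime_product_in[OF R] by blast
  have cancel: "dvd_in R (p * x) (p * y) \<longleftrightarrow> dvd_in R x y" for x y
    using pR by (auto simp: dvd_in_def mult.assoc)
  have pfac: "\<exists>k\<in>R. m = p * k" if "dvd_in R (p * a) m" for m
    using that subring_setD(5)[OF R aR] by (auto simp: dvd_in_def mult.assoc)
  show ?case
  proof (cases "dvd_in R p b")
    case True
    then obtain b' where b': "b' \<in> R" "b = p * b'" by (auto simp: dvd_in_def)
    obtain l where l: "l \<in> R" "dvd_in R a l" "dvd_in R b' l"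
      "\<And>m. m \<in> R \<Longrightarrow> dvd_in R a m \<Longrightarrow> dvd_in R b' m \<Longrightarrow> dvd_in R l m"
      using mult.IH[OF b'(1)] by blast
    have "dvd_in R (p * l) m" if m: "m \<in> R" "dvd_in R (p * a) m" "dvd_in R b m" for m
      using pfac[OF m(2)] m(2,3) l(4) cancel b' by auto
    then show ?thesis using l cancel b' subring_setD(5)[OF R pR(1) l(1)]
      by (intro bexI[of _ "p * l"]) auto
  next
    case False
    obtain l where l: "l \<in> R" "dvd_in R a l" "dvd_in R b l"
      "\<And>m. m \<in> R \<Longrightarrow> dvd_in R a m \<Longrightarrow> dvd_in R b m \<Longrightarrow> dvd_in R l m"
      using mult.IH[OF mult.prems] by blast
    have "dvd_in R (p * l) m" if m: "m \<in> R" "dvd_in R (p * a) m" "dvd_in R b m" for m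
    proof -
      obtain k where k: "k \<in> R" "m = p * k" using pfac[OF m(2)] by blast
      obtain c where c: "c \<in> R" "p * k = b * c" using m(3) k by (auto simp: dvd_in_def)
      have "dvd_in R p (b * c)" using c k unfolding dvd_in_def by metis
      then have "dvd_in R p c" using mult.hyps(1) False mult.prems c by (auto simp: prime_in_def)
      then obtain d where d: "d \<in> R" "c = p * d" by (auto simp: dvd_in_def)
      have "p * k = p * (b * d)" using c d by (simp add: ac_simps)
      then have "dvd_in R b k" using pR d by (auto simp: dvd_in_def)
      then show ?thesis using l(4) k m(2) cancel by auto
    qed
    moreover have "dvd_in R b (p * l)" using l(3) pR dvd_in_mult_left[OF R] by blast
    ultimately show ?thesis using l cancel subring_setD(5)[OF R pR(1) l(1)]
      by (intro bexI[of _ "p * l"]) auto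
  qed
qed

lemma lcm_set_in_exists:
  fixes R :: "'r::idom set"
  assumes R: "factorial_in R" and "finite A" "A \<subseteq> R" "0 \<notin> A"
  shows "\<exists>l\<in>R. (\<forall>a\<in>A. dvd_in R a l) \<and> (\<forall>m\<in>R. (\<forall>a\<in>A. dvd_in R a m) \<longrightarrow> dvd_in R l m)"
  using assms(2-)
proof (induction A rule: finite_induct)
  case empty
  then show ?case using R
    by (intro bexI[of _ 1]) (auto simp: factorial_in_def dvd_in_def intro: subring_setD)
next
  case (insert a A)
  have SR: "subring_set R" using R by (simp add: factorial_in_def)
  obtain l where l: "l \<in> R" "\<forall>a\<in>A. dvd_in R a l"
    "\<And>m. m \<in> R \<Longrightarrow> (\<forall>a\<in>A. dvd_in R a m) \<Longrightarrow> dvd_in R l m"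
    using insert by auto
  have "prime_product R a" using insert.prems R by (auto simp: factorial_in_def)
  then obtain l' where l': "l' \<in> R" "dvd_in R a l'" "dvd_in R l l'"
    "\<And>m. m \<in> R \<Longrightarrow> dvd_in R a m \<Longrightarrow> dvd_in R l m \<Longrightarrow> dvd_in R l' m"
    using lcm_in_exists[OF SR _ l(1)] by metis
  have "dvd_in R b l'" if "b \<in> A" for b using l(2) l'(3) dvd_in_trans[OF SR] that by blast
  then show ?case using l(3) l' by (intro bexI[of _ l']) auto
qed

section \<open>Multivariate power series and polynomials\<close>

definition deg :: "'v::finite mon \<Rightarrow> nat" where
  "deg w = (\<Sum>i\<in>UNIV. w i)"

lemma deg_add: "deg (a + b) = deg a + deg b"
  by (simp add: deg_def sum.distrib)

lemma le_deg: "w i \<le> deg w"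
  unfolding deg_def by (rule member_le_sum) auto

lemma deg_mono: "a \<le> b \<Longrightarrow> deg a \<le> deg b"
  unfolding deg_def by (intro sum_mono) (auto simp: le_fun_def)

lemma deg_eq_0_iff: "deg w = 0 \<longleftrightarrow> w = 0"
  by (auto simp: deg_def fun_eq_iff)

lemma mon_le_add_diff: "(a :: 'v mon) \<le> w \<Longrightarrow> a + (w - a) = w"
  by (auto simp: le_fun_def fun_eq_iff)

lemma deg_diff: "a \<le> w \<Longrightarrow> deg (w - a) = deg w - deg a"
  using deg_add[of a "w - a"] mon_le_add_diff[of a w] by simp

lemma mon_add_diff [simp]: "(a + b) - a = (b :: 'v mon)" "(b + a) - a = (b :: 'v mon)"
  by (auto simp: fun_eq_iff)

lemma mon_le_add [simp]: "a \<le> a + (b :: 'v mon)" "a \<le> b + (a :: 'v mon)"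
  by (auto simp: le_fun_def)

lemma mon_zero_le [simp]: "(0 :: 'v mon) \<le> a"
  by (auto simp: le_fun_def)

lemma mon_le_zero_iff [simp]: "a \<le> (0 :: 'v mon) \<longleftrightarrow> a = 0"
  by (auto simp: le_fun_def fun_eq_iff)

lemma mon_diff_le: "w - a \<le> (w :: 'v mon)"
  by (auto simp: le_fun_def)

lemma mon_diff_diff: "(a :: 'v mon) \<le> w \<Longrightarrow> w - (w - a) = a"
  by (auto simp: le_fun_def fun_eq_iff)

lemma mon_diff_add: "k \<le> v \<Longrightarrow> (v - k) + h + k = v + (h :: 'v mon)"
  by (simp add: fun_eq_iff le_fun_def trans_le_add1)

lemma finite_mon_le [simp]: "finite {a. a \<le> (w :: 'v::finite mon)}"
proof -
  have "{a. a \<le> w} = PiE UNIV (\<lambda>i. {..w i})"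
    by (auto simp: PiE_def le_fun_def)
  then show ?thesis by (simp add: finite_PiE)
qed

lemma finite_deg_le: "finite {w :: 'v::finite mon. deg w \<le> k}"
  by (rule finite_subset[OF _ finite_mon_le[of "\<lambda>_. k"]])
    (auto simp: le_fun_def intro: order.trans[OF le_deg])

locale graded_order =
  fixes ord :: "'v::finite mon \<Rightarrow> 'v mon \<Rightarrow> bool"
  assumes graded: "graded_term_order ord"
begin

lemma ord_irrefl: "\<not> ord a a"
  and ord_trans: "ord a b \<Longrightarrow> ord b c \<Longrightarrow> ord a c"
  and ord_total: "a \<noteq> b \<Longrightarrow> ord a b \<or> ord b a"
  and ord_add: "ord a b \<Longrightarrow> ord (a + c) (b + c)"
  and ord_deg: "deg a < deg b \<Longrightarrow> ord a b"
  using graded unfolding graded_term_order_def deg_def plus_fun_def by blast+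

lemma ord_antisym: "ord a b \<Longrightarrow> \<not> ord b a"
  using ord_irrefl ord_trans by blast

lemma ord_add_left: "ord a b \<Longrightarrow> ord (c + a) (c + b)"
  using ord_add[of a b c] by (simp add: add.commute)

lemma ord_add_cancel: "ord (a + c) (b + c) \<longleftrightarrow> ord a b"
  using ord_add ord_total ord_antisym ord_irrefl by metis

lemma ord_imp_deg_le: "ord a b \<Longrightarrow> deg a \<le> deg b"
  using ord_antisym ord_deg not_le by blast

lemma ord_add_right_pos: "k \<noteq> 0 \<Longrightarrow> ord a (a + k)"
  by (rule ord_deg) (use deg_eq_0_iff[of k] in \<open>auto simp: deg_add\<close>)

lemma finite_ord_below: "finite {v. ord v w}"
  by (rule finite_subset[OF _ finite_deg_le[of "deg w"]]) (use ord_imp_deg_le in auto)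

text \<open>Grading makes every initial segment finite, so its cardinality is a strictly monotone
  measure.\<close>

lemma wfp_ord: "wfP ord"
proof -
  have "card {u. ord u v} < card {u. ord u w}" if "ord v w" for v w
    using that ord_trans ord_irrefl by (intro psubset_card_mono finite_ord_below) blast
  then have "{(v, w). ord v w} \<subseteq> measure (\<lambda>w. card {u. ord u w})" by auto
  then have "wf {(v, w). ord v w}" using wf_subset[OF wf_measure] by blast
  then show ?thesis by (simp add: wfp_def)
qed

lemmas ord_induct = wfp_induct_rule[OF wfp_ord]

lemma ord_least:
  assumes "w \<in> A"
  obtains m where "m \<in> A" "\<And>v. ord v m \<Longrightarrow> v \<notin> A"
  using wfp_ord assms unfolding wfp_eq_minimal by metis

lemma ord_greatest:
  assumes "finite A" "A \<noteq> {}"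
  obtains m where "m \<in> A" "\<And>v. v \<in> A \<Longrightarrow> v \<noteq> m \<Longrightarrow> ord v m"
proof -
  have "\<exists>m\<in>A. \<forall>v\<in>A. v \<noteq> m \<longrightarrow> ord v m"
    using assms
  proof (induction A rule: finite_ne_induct)
    case (insert x A)
    then obtain m where m: "m \<in> A" "\<forall>v\<in>A. v \<noteq> m \<longrightarrow> ord v m" by blast
    show ?case
    proof (cases "ord x m")
      case True then show ?thesis using m by auto
    next
      case False
      then have "ord m x" using m(1) insert.hyps ord_total by metis
      then show ?thesis using m ord_trans by (intro bexI[of _ x]) auto
    qed
  qed auto
  then show ?thesis using that by blast
qed

end

text \<open>A type class instance cannot refer to the order fixed in the theorem, so the proof that
  series form a domain needs an order of its own: total degree, with ties broken lexicographically
  along an injection of the variables into nat.\<close>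

lemma graded_term_order_exists: "\<exists>ord :: 'v::finite mon \<Rightarrow> 'v mon \<Rightarrow> bool. graded_term_order ord"
proof -
  obtain h :: "'v \<Rightarrow> nat" where h: "inj h"
    using finite_imp_inj_to_nat_seg[of "UNIV :: 'v set"] by auto
  define lex :: "'v mon \<Rightarrow> 'v mon \<Rightarrow> bool" where
    "lex a b \<longleftrightarrow> (\<exists>i. a i < b i \<and> (\<forall>j. h j < h i \<longrightarrow> a j = b j))" for a b
  define ord :: "'v mon \<Rightarrow> 'v mon \<Rightarrow> bool" where
    "ord a b \<longleftrightarrow> (\<Sum>i\<in>UNIV. a i) < (\<Sum>i\<in>UNIV. b i) \<or>
      (\<Sum>i\<in>UNIV. a i) = (\<Sum>i\<in>UNIV. b i) \<and> lex a b" for a b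
  have lex_trans: "lex a c" if ab: "lex a b" and bc: "lex b c" for a b c
  proof -
    obtain i j where i: "a i < b i" "\<forall>k. h k < h i \<longrightarrow> a k = b k"
      and j: "b j < c j" "\<forall>k. h k < h j \<longrightarrow> b k = c k" using ab bc by (auto simp: lex_def)
    consider "h i < h j" | "h j < h i" | "i = j" using h by (metis injD linorder_neqE_nat)
    then show ?thesis
    proof cases
      case 1 then show ?thesis using i j unfolding lex_def by (intro exI[of _ i]) auto
    next
      case 2 then show ?thesis using i j unfolding lex_def by (intro exI[of _ j]) auto
    next
      case 3 then show ?thesis using i j unfolding lex_def by (intro exI[of _ i]) auto
    qed
  qed
  have lex_total: "lex a b \<or> lex b a" if neq: "a \<noteq> b" for a b
  proof -
    obtain i0 where "a i0 \<noteq> b i0" using neq by (auto simp: fun_eq_iff)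
    then obtain i where i: "a i \<noteq> b i" "\<And>j. a j \<noteq> b j \<Longrightarrow> h i \<le> h j"
      using ex_has_least_nat[of "\<lambda>i. a i \<noteq> b i" i0 h] by blast
    then have *: "\<forall>j. h j < h i \<longrightarrow> a j = b j" by (meson not_le)
    from i(1) have "a i < b i \<or> b i < a i" by auto
    then show ?thesis unfolding lex_def using * by metis
  qed
  have "graded_term_order ord"
    unfolding graded_term_order_def
  proof (intro conjI allI impI)
    show "\<not> ord a a" for a by (auto simp: ord_def lex_def)
    show "ord a c" if "ord a b" "ord b c" for a b c using that lex_trans unfolding ord_def by auto
    show "ord a b \<or> ord b a" if "a \<noteq> b" for a b using lex_total[OF that] unfolding ord_def by auto
    show "ord (\<lambda>i. a i + c i) (\<lambda>i. b i + c i)" if "ord a b" for a b c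
      using that unfolding ord_def lex_def by (auto simp: sum.distrib)
  qed (auto simp: ord_def)
  then show ?thesis by blast
qed

section \<open>The domain of formal power series\<close>

typedef ('v, 'a) mps = "UNIV :: ('v mon \<Rightarrow> 'a) set"
  morphisms coef Mps by auto

lemma coef_Mps [simp]: "coef (Mps f) = f" by (simp add: Mps_inverse)

lemma mps_eqI: "(\<And>w. coef f w = coef g w) \<Longrightarrow> f = g"
  by (simp add: coef_inject[symmetric] fun_eq_iff)

lemma mps_eq_iff: "f = g \<longleftrightarrow> (\<forall>w. coef f w = coef g w)"
  using mps_eqI by auto

text \<open>Functions already carry pointwise arithmetic, which exponent vectors rely on; the
  separate type makes room for the Cauchy product.\<close>

instantiation mps :: (finite, comm_ring_1) comm_ring_1
begin

definition "0 = Mps (\<lambda>_. 0)"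
definition "1 = Mps (\<lambda>w. if w = 0 then 1 else 0)"
definition "f + g = Mps (\<lambda>w. coef f w + coef g w)"
definition "f - g = Mps (\<lambda>w. coef f w - coef g w)"
definition "- f = Mps (\<lambda>w. - coef f w)"
definition "f * g = Mps (pmul (coef f) (coef g))"

lemma coef_simps [simp]:
  "coef 0 w = 0" "coef 1 w = (if w = 0 then 1 else 0)"
  "coef (f + g) w = coef f w + coef g w" "coef (f - g) w = coef f w - coef g w"
  "coef (- f) w = - coef f w"
  by (simp_all add: zero_mps_def one_mps_def plus_mps_def minus_mps_def uminus_mps_def)

lemma coef_mult: "coef (f * g) w = (\<Sum>a | a \<le> w. coef f a * coef g (w - a))"
  by (simp add: times_mps_def pmul_def fun_diff_def)

instance
proof
  fix f g h :: "('a, 'b) mps"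
  show "f * g * h = f * (g * h)"
  proof (rule mps_eqI)
    fix w
    have "coef (f * g * h) w =
        (\<Sum>(a, b)\<in>(SIGMA a:{a. a \<le> w}. {b. b \<le> a}). coef f b * coef g (a - b) * coef h (w - a))"
      by (simp add: coef_mult sum_distrib_right sum.Sigma)
    also have "\<dots> = (\<Sum>(b, c)\<in>(SIGMA b:{b. b \<le> w}. {c. c \<le> w - b}).
        coef f b * (coef g c * coef h (w - b - c)))"
    proof (rule sum.reindex_bij_witness[of _ "\<lambda>(b, c). (b + c, b)" "\<lambda>(a, b). (b, a - b)"], goal_cases)
      case (1 x)
      then show ?case by (auto simp: mon_le_add_diff)
    next
      case (2 x)
      then show ?case by (auto simp: le_fun_def diff_le_mono intro: order.trans)
    next
      case (3 x)
      then show ?case by auto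
    next
      case (4 x)
      then obtain b c where x: "x = (b, c)" "b \<le> w" "c \<le> w - b" by auto
      then have "b + c \<le> w" using add_left_mono[of c "w - b" b] mon_le_add_diff[of b w] by simp
      then show ?case using x by auto
    next
      case (5 x)
      then obtain a b where x: "x = (a, b)" "a \<le> w" "b \<le> a" by auto
      then have "w - b - (a - b) = w - a" by (auto simp: fun_eq_iff le_fun_def)
      then show ?case using x by (simp add: mult.assoc)
    qed
    also have "\<dots> = coef (f * (g * h)) w"
      by (simp add: coef_mult sum_distrib_left sum.Sigma)
    finally show "coef (f * g * h) w = coef (f * (g * h)) w" .
  qed
  show "f * g = g * f"
  proof (rule mps_eqI)
    fix w
    show "coef (f * g) w = coef (g * f) w" unfolding coef_mult
      by (rule sum.reindex_bij_witness[of _ "\<lambda>a. w - a" "\<lambda>a. w - a"])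
        (auto simp: mon_diff_diff mon_diff_le mult.commute)
  qed
  show "1 * f = f"
  proof (rule mps_eqI)
    fix w
    have "coef (1 * f) w = (\<Sum>a | a \<le> w. if a = 0 then coef f w else 0)"
      unfolding coef_mult by (intro sum.cong) auto
    then show "coef (1 * f) w = coef f w" by simp
  qed
  show "(f + g) * h = f * h + g * h"
    by (rule mps_eqI) (simp add: coef_mult distrib_right sum.distrib)
  show "(0::('a, 'b) mps) \<noteq> 1"
    by (auto simp: mps_eq_iff intro!: exI[of _ 0])
qed (auto intro!: mps_eqI simp: algebra_simps)

end

lemma coef_sum [simp]: "coef (sum f A) w = (\<Sum>a\<in>A. coef (f a) w)"
  by (induction A rule: infinite_finite_induct) auto

lemma coef_mult_0 [simp]: "coef (f * g) 0 = coef f 0 * coef g 0"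
  by (simp add: coef_mult)

lemma coef_prod_0: "coef (prod f A) 0 = (\<Prod>a\<in>A. coef (f a) 0)"
  by (induction A rule: infinite_finite_induct) (simp_all flip: zero_fun_def)

lemma coef_of_nat_mult: "coef (of_nat n * f) w = of_nat n * coef f w"
  by (induction n) (auto simp: algebra_simps)

text \<open>Initial terms multiply: an index below \<open>a\<close> kills the factor from
  \<open>f\<close>, and an index above \<open>a\<close> pushes the complementary one below
  \<open>b\<close>, since the order cancels addition.\<close>

lemma (in graded_order) coef_mult_least:
  assumes a: "\<And>v. ord v a \<Longrightarrow> coef f v = 0" and b: "\<And>v. ord v b \<Longrightarrow> coef g v = 0"
  shows "coef (f * g) (a + b) = coef f a * coef g b"
proof -
  have "coef f c * coef g (a + b - c) = 0" if "c \<le> a + b" "c \<noteq> a" for c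
  proof (cases "ord c a")
    case True then show ?thesis using a by simp
  next
    case False
    then have "ord a c" using that ord_total by blast
    then have "ord (a + b) (b + c)" using ord_add[of a c b] by (simp add: add.commute)
    then have "ord (a + b - c + c) (b + c)" using mon_le_add_diff[OF that(1)] by (simp add: add.commute)
    then have "ord (a + b - c) b" by (simp only: ord_add_cancel)
    then show ?thesis using b by simp
  qed
  then have "coef (f * g) (a + b) = (\<Sum>c | c \<le> a + b. if c = a then coef f a * coef g b else 0)"
    unfolding coef_mult by (intro sum.cong) auto
  then show ?thesis by simp
qed

instance mps :: (finite, idom) idom
proof
  fix f g :: "('a, 'b) mps"
  assume fg: "f \<noteq> 0" "g \<noteq> 0"
  obtain ord :: "'a mon \<Rightarrow> 'a mon \<Rightarrow> bool" where "graded_term_order ord"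
    using graded_term_order_exists by blast
  then interpret graded_order ord by unfold_locales
  obtain a b where ab: "coef f a \<noteq> 0" "coef g b \<noteq> 0"
    "\<And>v. ord v a \<Longrightarrow> coef f v = 0" "\<And>v. ord v b \<Longrightarrow> coef g v = 0"
    using fg ord_least[of _ "{w. coef f w \<noteq> 0}"] ord_least[of _ "{w. coef g w \<noteq> 0}"]
    by (auto simp: mps_eq_iff) metis
  then show "f * g \<noteq> 0" using coef_mult_least[of a f b g] by (metis coef_simps(1) mult_eq_0_iff)
qed

text \<open>Solves \<open>f * g = 1\<close> for the coefficient of \<open>g\<close> at
  \<open>w\<close>; the remaining summands involve only coefficients of \<open>g\<close> of smaller
  degree.\<close>

function recip_coef :: "('v::finite mon \<Rightarrow> 'a::field) \<Rightarrow> 'v mon \<Rightarrow> 'a" where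
  "recip_coef f w = (if w = 0 then inverse (f 0)
     else - inverse (f 0) * (\<Sum>a\<in>{a. a \<le> w \<and> a \<noteq> 0}. f a * recip_coef f (w - a)))"
  by auto
termination
proof (relation "measure (\<lambda>(f, w). deg w)", goal_cases)
  case (2 f w a)
  then show ?case using deg_diff[of a w] deg_mono[of a w] deg_eq_0_iff[of a] by auto
qed simp

declare recip_coef.simps [simp del]

lemma mps_unit:
  fixes f :: "('v::finite, 'a::field) mps"
  assumes "coef f 0 \<noteq> 0"
  obtains g where "f * g = 1"
proof
  show "f * Mps (recip_coef (coef f)) = 1"
  proof (rule mps_eqI)
    fix w
    let ?r = "recip_coef (coef f)"
    show "coef (f * Mps ?r) w = coef 1 w"
    proof (cases "w = 0")
      case True then show ?thesis using assms by (simp add: recip_coef.simps)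
    next
      case False
      have "coef (f * Mps ?r) w = coef f 0 * ?r w + (\<Sum>a\<in>{a. a \<le> w} - {0}. coef f a * ?r (w - a))"
        unfolding coef_mult by (subst sum.remove[of _ 0]) auto
      also have "{a. a \<le> w} - {0} = {a. a \<le> w \<and> a \<noteq> 0}" by auto
      finally have "coef (f * Mps ?r) w =
        coef f 0 * ?r w + (\<Sum>a\<in>{a. a \<le> w \<and> a \<noteq> 0}. coef f a * ?r (w - a))" .
      also have "coef f 0 * ?r w = - (\<Sum>a\<in>{a. a \<le> w \<and> a \<noteq> 0}. coef f a * ?r (w - a))"
        unfolding recip_coef.simps[of "coef f" w] if_not_P[OF False] mult.assoc[symmetric]
          mult_minus_right right_inverse[OF assms] by simp
      finally show ?thesis using False by (simp only: left_minus coef_simps if_False)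
    qed
  qed
qed

section \<open>Polynomial subrings and their factoriality\<close>

definition polys :: "'v set \<Rightarrow> ('v, 'a::zero) mps set" where
  "polys V = {f. finite {w. coef f w \<noteq> 0} \<and> (\<forall>w. coef f w \<noteq> 0 \<longrightarrow> (\<forall>i. i \<notin> V \<longrightarrow> w i = 0))}"

lemma polys_UNIV_iff: "f \<in> polys UNIV \<longleftrightarrow> is_poly (coef f)"
  by (simp add: polys_def is_poly_def)

lemma coef_mult_nonzeroE:
  assumes "coef (f * g) w \<noteq> 0"
  obtains a b where "coef f a \<noteq> 0" "coef g b \<noteq> 0" "w = a + b"
proof -
  obtain a where "a \<le> w" "coef f a * coef g (w - a) \<noteq> 0"
    using assms unfolding coef_mult by (metis (mono_tags, lifting) mem_Collect_eq sum.neutral)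
  then show ?thesis using that[of a "w - a"] mon_le_add_diff[of a w] mult_not_zero by metis
qed

lemma polys_coef_eq_0: "f \<in> polys V \<Longrightarrow> i \<notin> V \<Longrightarrow> w i \<noteq> 0 \<Longrightarrow> coef f w = 0"
  by (auto simp: polys_def)

lemma subring_set_polys: "subring_set (polys V :: ('v::finite, 'a::comm_ring_1) mps set)"
proof -
  have "f * g \<in> polys V" if f: "f \<in> polys V" and g: "g \<in> polys V" for f g :: "('v, 'a) mps"
  proof -
    have "{w. coef (f * g) w \<noteq> 0} \<subseteq> (\<lambda>(a, b). a + b) ` ({w. coef f w \<noteq> 0} \<times> {w. coef g w \<noteq> 0})"
      by (auto elim!: coef_mult_nonzeroE)
    then have "finite {w. coef (f * g) w \<noteq> 0}"
      using f g by (auto simp: polys_def intro: finite_subset)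
    moreover have "w i = 0" if w: "coef (f * g) w \<noteq> 0" and i: "i \<notin> V" for w i
    proof -
      obtain a b where "coef f a \<noteq> 0" "coef g b \<noteq> 0" "w = a + b"
        using coef_mult_nonzeroE[OF w] .
      then show ?thesis using polys_coef_eq_0 i f g by (metis add.right_neutral plus_fun_apply)
    qed
    ultimately show ?thesis by (simp add: polys_def)
  qed
  moreover have "f + g \<in> polys V" if f: "f \<in> polys V" and g: "g \<in> polys V" for f g :: "('v, 'a) mps"
  proof -
    have "{w. coef (f + g) w \<noteq> 0} \<subseteq> {w. coef f w \<noteq> 0} \<union> {w. coef g w \<noteq> 0}" by auto
    then show ?thesis using f g unfolding polys_def by (auto intro: finite_subset)
  qed
  moreover have "f - g \<in> polys V" if f: "f \<in> polys V" and g: "g \<in> polys V" for f g :: "('v, 'a) mps"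
  proof -
    have "{w. coef (f - g) w \<noteq> 0} \<subseteq> {w. coef f w \<noteq> 0} \<union> {w. coef g w \<noteq> 0}" by auto
    then show ?thesis using f g unfolding polys_def by (auto intro: finite_subset)
  qed
  moreover have "(1 :: ('v, 'a) mps) \<in> polys V" "(0 :: ('v, 'a) mps) \<in> polys V" by (auto simp: polys_def)
  ultimately show ?thesis unfolding subring_set_def by simp
qed

definition mps_var :: "'v \<Rightarrow> ('v, 'a::comm_ring_1) mps" where
  "mps_var v = Mps (\<lambda>w. if w = (\<lambda>i. if i = v then 1 else 0) then 1 else 0)"

lemma coef_mult_var:
  "coef (f * mps_var v) w = (if w v = 0 then 0 else coef f (w(v := w v - 1)))"
proof -
  let ?e = "\<lambda>i. if i = v then 1 else 0 :: nat"
  have "coef (f * mps_var v) w = (\<Sum>a | a \<le> w. if a = ?e then coef f (w - a) else 0)"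
    unfolding mult.commute[of f] coef_mult by (intro sum.cong) (auto simp: mps_var_def)
  also have "\<dots> = (if ?e \<le> w then coef f (w - ?e) else 0)"
    by (subst sum.delta[OF finite_mon_le]) simp
  also have "w - ?e = w(v := w v - 1)" by auto
  also have "?e \<le> w \<longleftrightarrow> w v \<noteq> 0" by (auto simp: le_fun_def)
  finally show ?thesis by simp
qed

lemma coef_mult_var_power:
  "coef (f * mps_var v ^ n) w = (if w v < n then 0 else coef f (w(v := w v - n)))"
proof (induction n arbitrary: w)
  case (Suc n)
  have "coef (f * mps_var v ^ Suc n) w = coef (f * mps_var v ^ n * mps_var v) w"
    by (simp only: power_Suc2 mult.assoc)
  moreover have "(w(v := w v - 1))(v := w v - 1 - n) = w(v := w v - Suc n)" by auto
  ultimately show ?case unfolding coef_mult_var Suc by (simp add: less_diff_conv) linarith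
qed simp

text \<open>The coefficients do not involve \<open>v\<close>, so only the one with index
  \<open>w v\<close> can contribute to the monomial \<open>w\<close>. Evaluation at the variable
  therefore loses no information, which yields injectivity and surjectivity onto
  \<open>polys (insert v V)\<close>.\<close>

lemma coef_poly_var:
  fixes p :: "('v::finite, 'a::comm_ring_1) mps poly"
  assumes p: "p \<in> poly_over (polys V)" and v: "v \<notin> V"
  shows "coef (poly p (mps_var v)) w = coef (coeff p (w v)) (w(v := 0))"
proof -
  have zero: "coef (coeff p i) u = 0" if "u v \<noteq> 0" for i u
    using p v that polys_coef_eq_0[of "coeff p i" V v u] by (simp add: poly_over_def)
  have "coef (poly p (mps_var v)) w =
      (\<Sum>i\<le>degree p. if w v < i then 0 else coef (coeff p i) (w(v := w v - i)))"
    by (simp add: poly_altdef coef_mult_var_power)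
  also have "\<dots> = (\<Sum>i\<le>degree p. if i = w v then coef (coeff p i) (w(v := 0)) else 0)"
    by (intro sum.cong refl) (auto intro: zero)
  also have "\<dots> = coef (coeff p (w v)) (w(v := 0))"
    using coeff_eq_0[of p "w v"] by (auto simp: not_le)
  finally show ?thesis .
qed

lemma polys_insert:
  assumes v: "v \<notin> V"
  shows "(\<lambda>p. poly p (mps_var v)) ` poly_over (polys V) =
    (polys (insert v V) :: ('v::finite, 'a::comm_ring_1) mps set)" (is "?\<phi> ` _ = _")
proof (intro equalityI subsetI)
  fix f :: "('v, 'a) mps" assume "f \<in> ?\<phi> ` poly_over (polys V)"
  then obtain p where p: "p \<in> poly_over (polys V)" "f = poly p (mps_var v)" by blast
  have c: "coeff p i \<in> polys (insert v V)" for i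
    using p by (auto simp: poly_over_def polys_def)
  have "(mps_var v :: ('v, 'a) mps) \<in> polys (insert v V)"
    by (auto simp: mps_var_def polys_def)
  then show "f \<in> polys (insert v V)"
    unfolding p poly_altdef using c
    by (intro subring_set_sum subring_setD(5) subring_set_power subring_set_polys)
next
  fix f :: "('v, 'a) mps" assume f: "f \<in> polys (insert v V)"
  \<comment> \<open>The part of \<open>f\<close> of degree \<open>i\<close> in the variable
    \<open>v\<close>, with that variable stripped.\<close>
  define c where "c i = Mps (\<lambda>w. if w v = 0 then coef f (w(v := i)) else 0)" for i
  have fin: "finite {w. coef f w \<noteq> 0}" using f by (simp add: polys_def)
  have c: "c i \<in> polys V" for i
  proof -
    have "{w. coef (c i) w \<noteq> 0} \<subseteq> (\<lambda>w. w(v := 0)) ` {w. coef f w \<noteq> 0}"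
    proof
      fix w assume "w \<in> {w. coef (c i) w \<noteq> 0}"
      then have "w v = 0" "coef f (w(v := i)) \<noteq> 0" by (auto simp: c_def split: if_splits)
      then show "w \<in> (\<lambda>w. w(v := 0)) ` {w. coef f w \<noteq> 0}"
        by (intro image_eqI[of _ _ "w(v := i)"]) (auto simp: fun_eq_iff)
    qed
    moreover have "w j = 0" if "coef (c i) w \<noteq> 0" "j \<notin> V" for w j
    proof (cases "j = v")
      case True
      then show ?thesis using that by (auto simp: c_def split: if_splits)
    next
      case False
      have "coef f (w(v := i)) \<noteq> 0" using that by (auto simp: c_def split: if_splits)
      then have "(w(v := i)) j = 0" using f that(2) False unfolding polys_def by blast
      then show ?thesis using False by simp
    qed
    ultimately show ?thesis using fin by (auto simp: polys_def intro: finite_subset)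
  qed
  \<comment> \<open>The inserted 0 keeps the maximum meaningful when \<open>f\<close> is
    zero.\<close>
  define N where "N = Max (insert 0 ((\<lambda>w. w v) ` {w. coef f w \<noteq> 0}))"
  have N: "w v \<le> N" if "coef f w \<noteq> 0" for w
    unfolding N_def using that fin by (intro Max_ge) auto
  define p where "p = (\<Sum>i\<le>N. monom (c i) i)"
  have p: "p \<in> poly_over (polys V)" unfolding p_def
    using c by (intro subring_set_sum subring_set_poly_over monom_in_poly_over subring_set_polys)
  have cp: "coeff p i = (if i \<le> N then c i else 0)" for i
    unfolding p_def by (simp add: coeff_sum)
  have "f = poly p (mps_var v)"
  proof (rule mps_eqI)
    fix w
    show "coef f w = coef (poly p (mps_var v)) w"
      unfolding coef_poly_var[OF p v] cp using N[of w] by (auto simp: c_def)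
  qed
  then show "f \<in> ?\<phi> ` poly_over (polys V)" using p by blast
qed

lemma inj_on_poly_var:
  assumes v: "v \<notin> V"
  shows "inj_on (\<lambda>p. poly p (mps_var v :: ('v::finite, 'a::comm_ring_1) mps)) (poly_over (polys V))"
proof (rule inj_onI)
  fix p q :: "('v, 'a) mps poly"
  assume p: "p \<in> poly_over (polys V)" and q: "q \<in> poly_over (polys V)"
    and eq: "poly p (mps_var v) = poly q (mps_var v)"
  have "coef (coeff p i) w = coef (coeff q i) w" for i w
  proof (cases "w v = 0")
    case True
    then have "(w(v := i))(v := 0) = w" by (auto simp: fun_eq_iff)
    then show ?thesis
      using coef_poly_var[OF p v, of "w(v := i)"] coef_poly_var[OF q v, of "w(v := i)"] eq by simp
  next
    case False
    have "coeff p i \<in> polys V" "coeff q i \<in> polys V" using p q by (auto simp: poly_over_def)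
    then have "coef (coeff p i) w = 0" "coef (coeff q i) w = 0"
      using v False by (auto intro: polys_coef_eq_0)
    then show ?thesis by simp
  qed
  then show "p = q" by (auto intro!: poly_eqI mps_eqI)
qed

text \<open>Without variables the ring is the field of constants, where nonzero elements are units;
  Gauss's theorem adjoins one variable at a time.\<close>

lemma factorial_in_polys:
  "factorial_in (polys V :: ('v::finite, 'a::field) mps set)"
  using finite[of V]
proof (induction V rule: finite_induct)
  case empty
  have unit: "dvd_in (polys {}) f 1"
    if f: "f \<in> polys {}" "f \<noteq> 0" for f :: "('v, 'a) mps"
  proof -
    have z: "coef f w = 0" if "w \<noteq> 0" for w
      using f that by (auto simp: polys_def fun_eq_iff)
    then have "coef f 0 \<noteq> 0" using f(2) by (metis coef_simps(1) mps_eqI)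
    define g :: "('v, 'a) mps" where "g = Mps (\<lambda>w. if w = 0 then inverse (coef f 0) else 0)"
    have "g \<in> polys {}" by (auto simp: g_def polys_def)
    moreover have "coef (f * g) w = coef 1 w" for w
    proof (cases "w = 0")
      case True then show ?thesis using \<open>coef f 0 \<noteq> 0\<close> by (simp add: g_def)
    next
      case False
      have "coef (f * g) w = 0"
      proof (rule ccontr)
        assume "coef (f * g) w \<noteq> 0"
        then obtain a b where "coef f a \<noteq> 0" "coef g b \<noteq> 0" "w = a + b" by (rule coef_mult_nonzeroE)
        then show False using z[of a] False by (auto simp: g_def split: if_splits)
      qed
      then show ?thesis using False by simp
    qed
    ultimately show ?thesis unfolding dvd_in_def by (metis mps_eqI)
  qed
  then show ?case unfolding factorial_in_def
    using subring_set_polys prime_product.unit by blast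
next
  case (insert v V)
  have "factorial_in ((\<lambda>p. poly p (mps_var v)) ` poly_over (polys V :: ('v, 'a) mps set))"
    by (rule factorial_in_image[OF factorial_in_poly_over[OF insert.IH] inj_on_poly_var]) (use insert in auto)
  then show ?case using polys_insert[OF insert.hyps(2), where ?'a = 'a] by simp
qed

section \<open>Divisibility by a prime in power series and in polynomials\<close>

lemma homogeneous_system_solution:
  fixes M :: "'e \<Rightarrow> 'u \<Rightarrow> 'a::field"
  assumes "finite E" "finite U" "card E < card U"
  shows "\<exists>x. (\<exists>u\<in>U. x u \<noteq> 0) \<and> (\<forall>e\<in>E. (\<Sum>u\<in>U. M e u * x u) = 0)"
  using assms
proof (induction E arbitrary: U M rule: finite_induct)
  case empty
  then have "U \<noteq> {}" by auto
  then show ?case by (intro exI[of _ "\<lambda>_. 1"]) auto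
next
  case (insert e E)
  show ?case
  proof (cases "\<forall>u\<in>U. M e u = 0")
    case True
    have "card E < card U" using insert by simp
    then obtain x where "\<exists>u\<in>U. x u \<noteq> 0" "\<forall>e\<in>E. (\<Sum>u\<in>U. M e u * x u) = 0"
      using insert.IH[OF insert.prems(1), of M] by blast
    then show ?thesis using True by (intro exI[of _ x]) auto
  next
    case False
    then obtain u0 where u0: "u0 \<in> U" "M e u0 \<noteq> 0" by blast
    define V where "V = U - {u0}"
    have V: "finite V" "card E < card V" "u0 \<notin> V" "U = insert u0 V"
      using insert u0 by (auto simp: V_def)
    obtain x where x: "\<exists>u\<in>V. x u \<noteq> 0"
      and eq: "\<forall>d\<in>E. (\<Sum>u\<in>V. (M d u - M d u0 * M e u / M e u0) * x u) = 0"
      using insert.IH[OF V(1,2), of "\<lambda>d u. M d u - M d u0 * M e u / M e u0"] by blast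
    define x0 where "x0 = - (\<Sum>u\<in>V. M e u * x u) / M e u0"
    define y where "y = x(u0 := x0)"
    have sum_y: "(\<Sum>u\<in>U. M d u * y u) = M d u0 * x0 + (\<Sum>u\<in>V. M d u * x u)" for d
      unfolding V(4) using V(1,3) by (auto simp: y_def intro!: sum.cong)
    have "(\<Sum>u\<in>U. M d u * y u) = 0" if "d \<in> insert e E" for d
    proof (cases "d = e")
      case True
      then show ?thesis unfolding sum_y using u0 by (simp add: x0_def)
    next
      case False
      then have "0 = (\<Sum>u\<in>V. (M d u - M d u0 * M e u / M e u0) * x u)" using that eq by auto
      also have "\<dots> = (\<Sum>u\<in>V. M d u * x u - (M d u0 / M e u0) * (M e u * x u))"
        by (intro sum.cong) (auto simp: algebra_simps)
      also have "\<dots> = (\<Sum>u\<in>V. M d u * x u) - (M d u0 / M e u0) * (\<Sum>u\<in>V. M e u * x u)"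
        by (simp add: sum_subtractf sum_distrib_left)
      also have "\<dots> = (\<Sum>u\<in>U. M d u * y u)" unfolding sum_y by (simp add: x0_def)
      finally show ?thesis by simp
    qed
    moreover have "\<exists>u\<in>U. y u \<noteq> 0" using x V by (auto simp: y_def)
    ultimately show ?thesis by blast
  qed
qed

definition mon_count :: "'v::finite itself \<Rightarrow> nat \<Rightarrow> nat" where
  "mon_count _ j = card {w :: 'v mon. deg w = j}"

lemma finite_deg_eq: "finite {w :: 'v::finite mon. deg w = j}"
  by (rule finite_subset[OF _ finite_deg_le[of j]]) auto

lemma finite_deg_less: "finite {w :: 'v::finite mon. deg w < k}"
  by (rule finite_subset[OF _ finite_deg_le[of k]]) auto

lemma card_deg_less: "card {w :: 'v::finite mon. deg w < k} = (\<Sum>j<k. mon_count TYPE('v) j)"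
proof -
  have "{w :: 'v mon. deg w < k} = (\<Union>j<k. {w. deg w = j})" by auto
  then have "card {w :: 'v mon. deg w < k} = card (\<Union>j<k. {w :: 'v mon. deg w = j})" by simp
  also have "\<dots> = (\<Sum>j<k. card {w :: 'v mon. deg w = j})"
    by (intro card_UN_disjoint) (auto simp: finite_deg_eq)
  finally show ?thesis by (simp add: mon_count_def)
qed

lemma deg_single: "deg (\<lambda>i. if i = v then n else 0) = n"
  by (simp add: deg_def)

lemma mon_count_mono: "i \<le> j \<Longrightarrow> mon_count TYPE('v::finite) i \<le> mon_count TYPE('v) j"
proof -
  assume "i \<le> j"
  \<comment> \<open>\<open>undefined\<close> is an arbitrary variable; one exists because types are
    inhabited.\<close>
  define e :: "'v mon" where "e = (\<lambda>k. if k = undefined then j - i else 0)"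
  have "(\<lambda>w. w + e) ` {w :: 'v mon. deg w = i} \<subseteq> {w. deg w = j}"
    using \<open>i \<le> j\<close> by (auto simp: deg_add e_def deg_single)
  moreover have "inj_on (\<lambda>w. w + e) {w :: 'v mon. deg w = i}" by (auto simp: inj_on_def)
  ultimately show ?thesis unfolding mon_count_def using card_inj_on_le finite_deg_eq by blast
qed

lemma mon_count_le: "mon_count TYPE('v::finite) j \<le> (j + 1) ^ card (UNIV :: 'v set)"
proof -
  have "{w :: 'v mon. deg w = j} \<subseteq> PiE UNIV (\<lambda>_. {..j})"
    using le_deg by (auto simp: PiE_def)
  then have "card {w :: 'v mon. deg w = j} \<le> card (PiE (UNIV :: 'v set) (\<lambda>_. {..j}))"
    by (intro card_mono finite_PiE) auto
  then show ?thesis by (simp add: mon_count_def card_PiE)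
qed

lemma mon_count_zero: "mon_count TYPE('v::finite) 0 = 1"
proof -
  have "{w :: 'v mon. deg w = 0} = {0}" by (auto simp: deg_eq_0_iff)
  then show ?thesis by (simp add: mon_count_def)
qed

text \<open>Otherwise the number of monomials of degree \<open>j\<close> would grow exponentially.\<close>

lemma mon_count_growth:
  assumes "a > 0"
  shows "\<exists>j. (a - 1) * mon_count TYPE('v::finite) (j + s) < a * mon_count TYPE('v) j"
proof (rule ccontr)
  assume "\<not> ?thesis"
  then have le: "a * mon_count TYPE('v) j \<le> (a - 1) * mon_count TYPE('v) (j + s)" for j
    by (meson not_le)
  define n where "n = card (UNIV :: 'v set)"
  have n: "n > 0" by (simp add: n_def card_gt_0_iff)
  \<comment> \<open>The negated inequality is chained along the degrees 0, s, 2s, ..., starting from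
    the single monomial of degree 0.\<close>
  have iter: "a ^ m \<le> (a - 1) ^ m * mon_count TYPE('v) (m * s)" for m
  proof (induction m)
    case (Suc m)
    have "a ^ Suc m \<le> a * ((a - 1) ^ m * mon_count TYPE('v) (m * s))" using Suc by simp
    also have "\<dots> = (a - 1) ^ m * (a * mon_count TYPE('v) (m * s))" by simp
    also have "\<dots> \<le> (a - 1) ^ m * ((a - 1) * mon_count TYPE('v) (m * s + s))"
      using le by (intro mult_left_mono) auto
    finally show ?case by (simp add: ac_simps)
  qed (simp add: mon_count_zero)
  define r where "r = real (a - 1) / real a"
  have r: "0 \<le> r" "r < 1" using assms by (auto simp: r_def)
  have ge: "1 \<le> r ^ m * (real s * real m + 1) ^ n" for m
  proof -
    have "a ^ m \<le> (a - 1) ^ m * (m * s + 1) ^ n"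
      using iter[of m] mon_count_le[of "m * s", where ?'v = 'v] mult_left_mono unfolding n_def
      by (meson le_trans zero_le)
    then have "real (a ^ m) \<le> real ((a - 1) ^ m * (m * s + 1) ^ n)" by (rule of_nat_mono)
    then have "real a ^ m \<le> real (a - 1) ^ m * (real s * real m + 1) ^ n"
      by (simp add: ac_simps)
    then show ?thesis using assms by (simp add: r_def power_divide field_simps)
  qed
  \<comment> \<open>The n-th root moves the polynomial factor inside: the bound becomes the n-th
    power of a sequence whose two summands tend to 0 by standard limits.\<close>
  define \<rho> where "\<rho> = root n r"
  have \<rho>: "norm \<rho> < 1" "\<rho> ^ n = r" using r n by (auto simp: \<rho>_def)
  have "(\<lambda>m. real s * (of_nat m * \<rho> ^ m) + \<rho> ^ m) \<longlonglongrightarrow> real s * 0 + 0"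
    using \<rho> by (intro tendsto_add tendsto_mult_left powser_times_n_limit_0 LIMSEQ_power_zero)
  then have "(\<lambda>m. (real s * (of_nat m * \<rho> ^ m) + \<rho> ^ m) ^ n) \<longlonglongrightarrow> (real s * 0 + 0) ^ n"
    by (rule tendsto_power)
  moreover have "(real s * (of_nat m * \<rho> ^ m) + \<rho> ^ m) ^ n = r ^ m * (real s * real m + 1) ^ n" for m
  proof -
    have "real s * (of_nat m * \<rho> ^ m) + \<rho> ^ m = \<rho> ^ m * (real s * real m + 1)"
      by (simp add: algebra_simps)
    then show ?thesis
      by (simp add: power_mult_distrib \<rho>(2)[symmetric] flip: power_mult) (simp add: mult.commute)
  qed
  ultimately have "(\<lambda>m. r ^ m * (real s * real m + 1) ^ n) \<longlonglongrightarrow> 0" using n by (simp add: zero_power)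
  then have "1 \<le> (0::real)" by (rule LIMSEQ_le_const) (use ge in auto)
  then show False by simp
qed

text \<open>The left side counts equations, the right side unknowns. For k = j + a + b, the
  monomials of degree below k - b not divisible by \<open>m\<close> are as many as those in the
  \<open>a\<close> layers of degrees j to j + a - 1, while the left side exceeds the first count on
  the right by only \<open>a - 1\<close> layers. The latter are larger, but for a suitable
  \<open>j\<close> not by enough to make up for the missing layer. That layer is the gain from k - 1
  in place of k, available because the prime has no constant term.\<close>

lemma monomial_count_inequality:
  fixes m :: "'v::finite mon"
  assumes a: "deg m = a" "a > 0"
  shows "\<exists>k. card {w :: 'v mon. deg w < k - 1} <
    card {w :: 'v mon. deg w < k - a} + card {w :: 'v mon. deg w < k - b \<and> \<not> m \<le> w}"
proof -
  let ?D = "\<lambda>k. card {w :: 'v mon. deg w < k}"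
  let ?c = "mon_count TYPE('v)"
  obtain j where j: "(a - 1) * ?c (j + (a + b)) < a * ?c j"
    using mon_count_growth[OF a(2)] by blast
  \<comment> \<open>Since \<open>a\<close> is positive and k - b = j + a, k - a = j + b, no
    truncated subtraction cuts anything off.\<close>
  define k where "k = j + a + b"
  have split: "?D (i + l) = ?D i + (\<Sum>j=i..<i+l. ?c j)" for i l
    using sum.atLeastLessThan_concat[of 0 i "i + l" ?c] by (simp add: card_deg_less lessThan_atLeast0)
  have "{w :: 'v mon. deg w < k - b \<and> m \<le> w} = (\<lambda>w. m + w) ` {w. deg w < j}"
  proof (intro equalityI subsetI)
    fix w assume "w \<in> {w :: 'v mon. deg w < k - b \<and> m \<le> w}"
    then have "deg w < j + a" "m \<le> w" by (auto simp: k_def)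
    then show "w \<in> (\<lambda>w. m + w) ` {w. deg w < j}"
      using mon_le_add_diff[of m w] deg_diff[of m w] deg_mono[of m w] a
      by (intro image_eqI[of _ _ "w - m"]) auto
  qed (auto simp: deg_add a k_def)
  then have c1: "card {w :: 'v mon. deg w < k - b \<and> m \<le> w} = ?D j"
    by (simp add: card_image inj_on_def)
  have "{w :: 'v mon. deg w < k - b} =
      {w. deg w < k - b \<and> m \<le> w} \<union> {w. deg w < k - b \<and> \<not> m \<le> w}" by auto
  then have "?D (k - b) = card ({w :: 'v mon. deg w < k - b \<and> m \<le> w} \<union> {w. deg w < k - b \<and> \<not> m \<le> w})"
    by (rule arg_cong[where f = card])
  also have "\<dots> = ?D j + card {w :: 'v mon. deg w < k - b \<and> \<not> m \<le> w}"
    unfolding c1[symmetric]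
    by (rule card_Un_disjoint) (auto intro: finite_subset[OF _ finite_deg_less[of "k - b"]])
  finally have c2: "card {w :: 'v mon. deg w < k - b \<and> \<not> m \<le> w} = (\<Sum>i=j..<j+a. ?c i)"
    using split[of j a] by (simp add: k_def)
  have "(\<Sum>i=j..<j+a. ?c i) \<ge> of_nat (card {j..<j+a}) * ?c j"
    by (rule sum_bounded_below) (auto intro: mon_count_mono)
  then have lower: "(\<Sum>i=j..<j+a. ?c i) \<ge> a * ?c j" by simp
  have "?D (k - 1) = ?D (k - a) + (\<Sum>i=k-a..<k-a+(a-1). ?c i)"
    using split[of "k - a" "a - 1"] a by (simp add: k_def ac_simps)
  moreover have "(\<Sum>i=k-a..<k-a+(a-1). ?c i) \<le> of_nat (card {k-a..<k-a+(a-1)}) * ?c (j + (a + b))"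
    by (rule sum_bounded_above) (auto intro!: mon_count_mono simp: k_def)
  ultimately show ?thesis using lower j c2 by (intro exI[of _ k]) simp
qed

context graded_order
begin

lemma coef_mult_greatest:
  assumes a: "\<And>v. ord a v \<Longrightarrow> coef f v = 0" and b: "\<And>v. ord b v \<Longrightarrow> coef g v = 0"
  shows "coef (f * g) (a + b) = coef f a * coef g b"
proof -
  have "coef f c * coef g (a + b - c) = 0" if "c \<le> a + b" "c \<noteq> a" for c
  proof (cases "ord a c")
    case True then show ?thesis using a by simp
  next
    case False
    then have "ord c a" using that ord_total by blast
    then have "ord (b + c) (a + b)" using ord_add[of c a b] by (simp add: add.commute)
    then have "ord (b + c) (a + b - c + c)" using mon_le_add_diff[OF that(1)] by (simp add: add.commute)
    then have "ord b (a + b - c)" by (simp only: ord_add_cancel)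
    then show ?thesis using b by simp
  qed
  then have "coef (f * g) (a + b) = (\<Sum>c | c \<le> a + b. if c = a then coef f a * coef g b else 0)"
    unfolding coef_mult by (intro sum.cong) auto
  then show ?thesis by simp
qed

lemma polys_greatest:
  assumes "f \<in> polys V" "f \<noteq> 0"
  obtains m where "coef f m \<noteq> 0" "\<And>v. ord m v \<Longrightarrow> coef f v = 0"
proof -
  have "finite {w. coef f w \<noteq> 0}" "{w. coef f w \<noteq> 0} \<noteq> {}"
    using assms mps_eqI[of f 0] by (auto simp: polys_def)
  then obtain m where "m \<in> {w. coef f w \<noteq> 0}" "\<And>v. v \<in> {w. coef f w \<noteq> 0} \<Longrightarrow> v \<noteq> m \<Longrightarrow> ord v m"
    using ord_greatest by metis
  then show ?thesis using that ord_antisym ord_irrefl by blast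
qed

text \<open>If \<open>p\<close> did not divide \<open>c = p s\<close>, a dimension count would give polynomials \<open>h\<close>, \<open>h'\<close> of degrees less
  than \<open>k - deg p\<close> and \<open>k - deg c\<close>, not both zero and no monomial of \<open>h'\<close> a multiple of the leading monomial
  of \<open>p\<close>, such that \<open>h + s h'\<close> has order at least \<open>k - 1\<close>. Then \<open>p h + c h' = p (h + s h')\<close> has order at
  least \<open>k\<close> and degree less than \<open>k\<close>, so it vanishes and \<open>p\<close> divides \<open>h'\<close>.\<close>

lemma prime_dvd_of_series_dvd:
  fixes p c s :: "('v, 'a::field) mps"
  assumes p: "prime_in (polys UNIV) p" and p0: "coef p 0 = 0"
    and c: "c \<in> polys UNIV" and cs: "c = p * s"
  shows "dvd_in (polys UNIV) p c"
proof (rule ccontr)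
  assume ndvd: "\<not> dvd_in (polys UNIV) p c"
  have pP: "p \<in> polys UNIV" and pnz: "p \<noteq> 0" using p by (auto simp: prime_in_def)
  obtain m where m: "coef p m \<noteq> 0" "\<And>v. ord m v \<Longrightarrow> coef p v = 0"
    using polys_greatest[OF pP pnz] by blast
  define a where "a = deg m"
  have "m \<noteq> 0" using m(1) p0 by metis
  then have a: "a > 0" using deg_eq_0_iff[of m] by (simp add: a_def)
  have dp: "deg w \<le> a" if "coef p w \<noteq> 0" for w
    using that m(2) ord_deg[of m w] unfolding a_def by (meson not_le)
  have "c \<noteq> 0" using ndvd subring_setD(1)[OF subring_set_polys] unfolding dvd_in_def by (metis mult_zero_right)
  then obtain mc where mc: "\<And>v. ord mc v \<Longrightarrow> coef c v = 0"
    using polys_greatest[OF c] by blast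
  define b where "b = deg mc"
  have dc: "deg w \<le> b" if "coef c w \<noteq> 0" for w
    using that mc ord_deg[of mc w] unfolding b_def by (meson not_le)
  obtain k where k: "card {w :: 'v mon. deg w < k - 1} <
      card {w :: 'v mon. deg w < k - a} + card {w :: 'v mon. deg w < k - b \<and> \<not> m \<le> w}"
    using monomial_count_inequality[OF a_def[symmetric] a] by blast
  define H where "H = {w :: 'v mon. deg w < k - a}"
  define H' where "H' = {w :: 'v mon. deg w < k - b \<and> \<not> m \<le> w}"
  have fin: "finite H" "finite H'"
    unfolding H_def H'_def by (auto intro: finite_subset[OF _ finite_deg_less])
  \<comment> \<open>Row \<open>w\<close> is the coefficient of \<open>h + h' * s\<close> at
    \<open>w\<close> as a linear form in the unknowns: \<open>Inl\<close> indexes the coefficients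
    of \<open>h\<close>, \<open>Inr\<close> those of \<open>h'\<close>.\<close>
  define M where "M = (\<lambda>w. case_sum (\<lambda>u. if u = w then 1 else 0) (\<lambda>u. if u \<le> w then coef s (w - u) else 0))"
  have "card {w :: 'v mon. deg w < k - 1} < card (H <+> H')"
    using k fin by (simp add: card_Plus H_def H'_def)
  then obtain x where x: "\<exists>u\<in>H <+> H'. x u \<noteq> 0"
    "\<And>w. deg w < k - 1 \<Longrightarrow> (\<Sum>u\<in>H <+> H'. M w u * x u) = 0"
    using homogeneous_system_solution[OF finite_deg_less finite_Plus[OF fin], of "k - 1" M] by blast
  define h where "h = Mps (\<lambda>w. if w \<in> H then x (Inl w) else 0)"
  define h' where "h' = Mps (\<lambda>w. if w \<in> H' then x (Inr w) else 0)"
  have h: "h \<in> polys UNIV" and h': "h' \<in> polys UNIV"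
    using fin by (auto simp: h_def h'_def polys_def intro: finite_subset)
  define g where "g = h + h' * s"
  have g0: "coef g w = 0" if w: "deg w < k - 1" for w
  proof -
    have "coef h w = (\<Sum>u\<in>H. if u = w then x (Inl u) else 0)"
      using fin by (simp add: h_def)
    also have "\<dots> = (\<Sum>u\<in>H. M w (Inl u) * x (Inl u))"
      by (intro sum.cong) (auto simp: M_def)
    finally have 1: "coef h w = (\<Sum>u\<in>H. M w (Inl u) * x (Inl u))" .
    have "coef (h' * s) w = (\<Sum>u | u \<le> w. if u \<in> H' then M w (Inr u) * x (Inr u) else 0)"
      unfolding coef_mult by (intro sum.cong) (auto simp: h'_def M_def)
    also have "\<dots> = (\<Sum>u\<in>{u. u \<le> w} \<inter> H'. M w (Inr u) * x (Inr u))"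
      by (simp add: sum.inter_restrict)
    also have "\<dots> = (\<Sum>u\<in>H'. M w (Inr u) * x (Inr u))"
      using fin by (intro sum.mono_neutral_left) (auto simp: M_def)
    finally have "coef g w = (\<Sum>u\<in>H <+> H'. M w u * x u)"
      using 1 fin by (simp add: g_def sum.Plus)
    then show ?thesis using x(2)[OF w] by simp
  qed
  have eq: "p * g = p * h + c * h'" by (simp add: g_def cs algebra_simps)
  have "coef (p * g) w = 0" for w
  proof (rule ccontr)
    assume nz: "coef (p * g) w \<noteq> 0"
    then obtain d e where de: "coef p d \<noteq> 0" "coef g e \<noteq> 0" "w = d + e" by (rule coef_mult_nonzeroE)
    have "d \<noteq> 0" using de(1) p0 by metis
    then have "deg d > 0" using deg_eq_0_iff[of d] by simp
    moreover have "\<not> deg e < k - 1" using g0[of e] de(2) by blast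
    moreover have "deg w = deg d + deg e" using de(3) deg_add by simp
    ultimately have ge: "k \<le> deg w" by linarith
    have "coef (p * h) w \<noteq> 0 \<or> coef (c * h') w \<noteq> 0" using nz unfolding eq by auto
    then have "deg w < k"
    proof
      assume "coef (p * h) w \<noteq> 0"
      then obtain d e where de: "coef p d \<noteq> 0" "coef h e \<noteq> 0" "w = d + e" by (rule coef_mult_nonzeroE)
      then have "deg e < k - a" by (auto simp: h_def H_def split: if_splits)
      then show ?thesis using dp[OF de(1)] de(3) deg_add[of d e] by simp
    next
      assume "coef (c * h') w \<noteq> 0"
      then obtain d e where de: "coef c d \<noteq> 0" "coef h' e \<noteq> 0" "w = d + e" by (rule coef_mult_nonzeroE)
      then have "deg e < k - b" by (auto simp: h'_def H'_def split: if_splits)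
      then show ?thesis using dc[OF de(1)] de(3) deg_add[of d e] by simp
    qed
    then show False using ge by simp
  qed
  then have pg: "p * g = 0" by (intro mps_eqI) simp
  then have "c * h' = p * (- h)" using eq by (simp add: eq_neg_iff_add_eq_0 add.commute)
  then have "dvd_in (polys UNIV) p (c * h')"
    unfolding dvd_in_def using subring_set_uminus[OF subring_set_polys h] by blast
  then have "dvd_in (polys UNIV) p h'" using p c h' ndvd by (auto simp: prime_in_def)
  then obtain q where q: "q \<in> polys UNIV" "h' = p * q" by (auto simp: dvd_in_def)
  \<comment> \<open>The leading monomial of \<open>p * q\<close> is a multiple of \<open>m\<close>,
    and these are exactly the monomials left out of \<open>H'\<close>. With \<open>h'\<close> gone,
    \<open>h\<close> vanishes too, against the nontrivial solution \<open>x\<close>.\<close>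
  have "q = 0"
  proof (rule ccontr)
    assume "q \<noteq> 0"
    then obtain m' where m': "coef q m' \<noteq> 0" "\<And>v. ord m' v \<Longrightarrow> coef q v = 0"
      using polys_greatest[OF q(1)] by blast
    have "coef h' (m + m') \<noteq> 0" using q(2) coef_mult_greatest[OF m(2) m'(2)] m(1) m'(1) by simp
    then have "m + m' \<in> H'" by (auto simp: h'_def split: if_splits)
    then show False by (simp add: H'_def)
  qed
  then have h'0: "h' = 0" using q by simp
  then have h0: "h = 0" using pg pnz eq by simp
  have "x (Inl u) = coef h u" if "u \<in> H" for u using that by (simp add: h_def)
  moreover have "x (Inr u) = coef h' u" if "u \<in> H'" for u using that by (simp add: h'_def)
  ultimately show False using x(1) h0 h'0 by auto
qed

end

section \<open>From solutions to ordinary points\<close>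

lemma Mps_pmul: "Mps (pmul c d) = Mps c * Mps d"
  by (simp add: times_mps_def)

lemma Mps_in_polys_iff: "Mps c \<in> polys UNIV \<longleftrightarrow> is_poly c"
  by (simp add: polys_UNIV_iff)

lemma Mps_eq_0_iff: "Mps c = 0 \<longleftrightarrow> c = (\<lambda>_. 0)"
  by (metis coef_Mps zero_mps_def)

lemma pdvd_iff: "pdvd d c \<longleftrightarrow> dvd_in (polys UNIV) (Mps d) (Mps c)"
proof
  assume "pdvd d c"
  then obtain r where "is_poly r" "pmul d r = c" by (auto simp: pdvd_def)
  then show "dvd_in (polys UNIV) (Mps d) (Mps c)"
    unfolding dvd_in_def using Mps_pmul Mps_in_polys_iff by metis
next
  assume "dvd_in (polys UNIV) (Mps d) (Mps c)"
  then obtain k where "k \<in> polys UNIV" "Mps c = Mps d * k" by (auto simp: dvd_in_def)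
  then have "is_poly (coef k)" "pmul d (coef k) = c"
    by (auto simp: polys_UNIV_iff times_mps_def Mps_inject)
  then show "pdvd d c" unfolding pdvd_def by blast
qed

lemma is_dop_Mps: "is_dop P \<Longrightarrow> Mps (P u) \<in> polys UNIV"
  by (simp add: is_dop_def Mps_in_polys_iff)

lemma dsupp_iff: "u \<in> dsupp P \<longleftrightarrow> Mps (P u) \<noteq> 0"
  by (simp add: dsupp_def Mps_eq_0_iff)

lemma Mps_dapply:
  fixes P :: "('v::finite, 'a::comm_ring_1) dop"
  shows "Mps (dapply P f) = (\<Sum>u\<in>dsupp P. Mps (P u) * Mps (pderivs u f))"
  by (rule mps_eqI) (simp add: dapply_def Mps_pmul[symmetric])

context graded_order
begin

lemma HT_eqI:
  assumes "u \<in> dsupp P" "\<And>v. v \<in> dsupp P \<Longrightarrow> v \<noteq> u \<Longrightarrow> ord v u"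
  shows "HT ord P = u"
  unfolding HT_def
proof (rule the_equality)
  show "u \<in> dsupp P \<and> (\<forall>v\<in>dsupp P. v \<noteq> u \<longrightarrow> ord v u)" using assms by simp
  show "x = u" if "x \<in> dsupp P \<and> (\<forall>v\<in>dsupp P. v \<noteq> x \<longrightarrow> ord v x)" for x
    using that assms ord_antisym by metis
qed

lemma HT_in_dsupp:
  assumes "finite (dsupp P)" "dsupp P \<noteq> {}"
  shows "HT ord P \<in> dsupp P" "v \<in> dsupp P \<Longrightarrow> v \<noteq> HT ord P \<Longrightarrow> ord v (HT ord P)"
proof -
  obtain m where "m \<in> dsupp P" "\<And>v. v \<in> dsupp P \<Longrightarrow> v \<noteq> m \<Longrightarrow> ord v m"
    using ord_greatest[OF assms] by blast
  moreover from this have "HT ord P = m" by (rule HT_eqI)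
  ultimately show "HT ord P \<in> dsupp P" "v \<in> dsupp P \<Longrightarrow> v \<noteq> HT ord P \<Longrightarrow> ord v (HT ord P)" by auto
qed

lemma init_exp_eqI:
  assumes "f w \<noteq> 0" "\<And>v. ord v w \<Longrightarrow> f v = 0"
  shows "init_exp ord f = w"
  unfolding init_exp_def
proof (rule the_equality)
  show "f w \<noteq> 0 \<and> (\<forall>v. ord v w \<longrightarrow> f v = 0)" using assms by simp
  show "x = w" if "f x \<noteq> 0 \<and> (\<forall>v. ord v x \<longrightarrow> f v = 0)" for x
    using that assms ord_total by metis
qed

lemma init_exp_props:
  assumes "f \<noteq> (\<lambda>_. 0)"
  shows "f (init_exp ord f) \<noteq> 0" "ord v (init_exp ord f) \<Longrightarrow> f v = 0"
proof -
  obtain w0 where "w0 \<in> {w. f w \<noteq> 0}" using assms by auto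
  then obtain w where "w \<in> {w. f w \<noteq> 0}" "\<And>v. ord v w \<Longrightarrow> v \<notin> {w. f w \<noteq> 0}"
    by (rule ord_least) blast
  then have w: "f w \<noteq> 0" "\<And>v. ord v w \<Longrightarrow> f v = 0" by auto
  then have "init_exp ord f = w" by (rule init_exp_eqI)
  then show "f (init_exp ord f) \<noteq> 0" "ord v (init_exp ord f) \<Longrightarrow> f v = 0" using w by auto
qed

text \<open>Eliminating the \<open>ord\<close>-largest unknown does not change the constant terms of the remaining system.\<close>

lemma dvd_of_triangular_system:
  fixes y :: "'v mon \<Rightarrow> ('v, 'a::field) mps"
  assumes "finite A"
    and "\<And>v. v \<in> A \<Longrightarrow> d dvd (\<Sum>u\<in>A. y u * W u v)"
    and "\<And>v. v \<in> A \<Longrightarrow> coef (W v v) 0 \<noteq> 0"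
    and "\<And>u v. u \<in> A \<Longrightarrow> v \<in> A \<Longrightarrow> ord u v \<Longrightarrow> coef (W u v) 0 = 0"
  shows "\<forall>u\<in>A. d dvd y u"
  using assms
proof (induction "card A" arbitrary: A W)
  case (Suc n)
  then have "A \<noteq> {}" by auto
  then obtain m where m: "m \<in> A" "\<And>v. v \<in> A \<Longrightarrow> v \<noteq> m \<Longrightarrow> ord v m"
    using ord_greatest Suc.prems(1) by metis
  define B where "B = A - {m}"
  have B: "finite B" "n = card B" "m \<notin> B" "A = insert m B"
    using Suc.hyps(2) Suc.prems(1) m(1) by (auto simp: B_def)
  obtain e where e: "W m m * e = 1" using mps_unit Suc.prems(3)[OF m(1)] by metis
  define S where "S v = (\<Sum>u\<in>A. y u * W u v)" for v
  have S: "S v = y m * W m v + (\<Sum>u\<in>B. y u * W u v)" for v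
    unfolding S_def B(4) using B by simp
  define W' where "W' u v = W u v - W m v * e * W u m" for u v
  have "(\<Sum>u\<in>B. y u * W' u v) = S v - W m v * e * S m" for v
  proof -
    have "(\<Sum>u\<in>B. y u * W' u v) = (\<Sum>u\<in>B. y u * W u v) - W m v * e * (\<Sum>u\<in>B. y u * W u m)"
      unfolding W'_def by (simp add: algebra_simps sum_subtractf sum_distrib_left)
    also have "\<dots> = S v - W m v * e * S m - y m * W m v + y m * W m v * (W m m * e)"
      unfolding S by (simp only: algebra_simps)
    finally show ?thesis using e by simp
  qed
  then have "d dvd (\<Sum>u\<in>B. y u * W' u v)" if "v \<in> B" for v
    using Suc.prems(2)[folded S_def] that B(4) by auto
  moreover have W'0: "coef (W' u v) 0 = coef (W u v) 0" if "u \<in> B" for u v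
    using Suc.prems(4)[of u m] m that B(3,4) unfolding W'_def by auto
  ultimately have yB: "\<forall>u\<in>B. d dvd y u"
    using Suc.prems(3,4) B(4) by (intro Suc.hyps(1)[OF B(2) B(1), of W']) (auto simp: W'0)
  \<comment> \<open>Back substitution: the other unknowns are settled and the pivot
    \<open>W m m\<close> is a unit.\<close>
  have "d dvd S m - (\<Sum>u\<in>B. y u * W u m)"
    using Suc.prems(2)[OF m(1), folded S_def] yB by (intro dvd_diff dvd_sum) auto
  then have "d dvd y m * W m m" unfolding S by simp
  then have "d dvd y m * W m m * e" by simp
  then have "d dvd y m" using e by (simp add: mult.assoc)
  then show ?case using yB B by auto
qed simp

end

text \<open>Constant terms are multiplicative and that of a unit is nonzero, so the zero comes from
  one of the primes.\<close>

lemma prime_factor_vanishing_at_0: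
  fixes a :: "('v::finite, 'a::field) mps"
  assumes "prime_product R a" "subring_set R" "coef a 0 = 0"
  shows "\<exists>p. prime_in R p \<and> coef p 0 = 0 \<and> dvd_in R p a"
  using assms
proof induction
  case (unit a)
  then obtain k where "1 = a * k" by (auto simp: dvd_in_def)
  then have "a * k = 1" by simp
  then have "coef a 0 * coef k 0 = 1" using coef_mult_0[of a k] by simp
  then show ?case using unit.prems(2) by (metis mult_zero_left zero_neq_one)
next
  case (mult p a)
  have "a \<in> R" "p \<in> R" using mult prime_product_in by (auto simp: prime_in_def)
  show ?case
  proof (cases "coef p 0 = 0")
    case True
    moreover have "dvd_in R p (p * a)" using \<open>a \<in> R\<close> by (auto simp: dvd_in_def)
    ultimately show ?thesis using mult.hyps(1) by blast
  next
    case False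
    then have "coef a 0 = 0" using mult.prems(2) unfolding coef_mult_0 by (metis mult_eq_0_iff)
    then show ?thesis using mult.IH mult.prems(1) \<open>p \<in> R\<close> dvd_in_mult_left by blast
  qed
qed

section \<open>Groebner bases, parametric terms and ordinary points\<close>

locale groebner_basis = graded_order ord
  for ord :: "'v::finite mon \<Rightarrow> 'v mon \<Rightarrow> bool" +
  fixes G :: "('v, 'a::field_char_0) dop set"
  assumes finite_G: "finite G"
    and dop: "g \<in> G \<Longrightarrow> is_dop g"
    and GB: "is_GB ord G"
    and reduced: "is_reduced ord G"
    and D_fin: "D_finite G"
begin

lemma nonzero: "g \<in> G \<Longrightarrow> dsupp g \<noteq> {}"
  using reduced unfolding is_reduced_def dsupp_def by (auto simp: fun_eq_iff)

lemma HT_G: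
  assumes "g \<in> G"
  shows "HT ord g \<in> dsupp g" "v \<in> dsupp g \<Longrightarrow> v \<noteq> HT ord g \<Longrightarrow> ord v (HT ord g)"
  using HT_in_dsupp[of g] nonzero[OF assms] dop[OF assms] by (auto simp: is_dop_def)

lemma hc_G:
  assumes "g \<in> G"
  shows "Mps (hc ord g) \<in> polys UNIV" "Mps (hc ord g) \<noteq> 0"
  using HT_G(1)[OF assms] is_dop_Mps[OF dop[OF assms]] by (auto simp: hc_def dsupp_iff)

lemma HT_notin_PT: "g \<in> G \<Longrightarrow> HT ord g \<notin> PT ord G"
  by (auto simp: PT_def)

lemma dsupp_subset: "g \<in> G \<Longrightarrow> dsupp g - {HT ord g} \<subseteq> PT ord G"
  using reduced by (auto simp: is_reduced_def PT_def)

text \<open>The head term of a nonzero \<open>L\<close> would be parametric and yet a multiple of a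
  head term of \<open>G\<close>. This is the independence of the parametric terms modulo the ideal;
  the finiteness of \<open>PT\<close> and the vanishing of remainders of ideal elements both rest on
  it.\<close>

lemma ideal_PT_zero:
  assumes L: "is_dop L" "in_ideal G L" "dsupp L \<subseteq> PT ord G"
  shows "dsupp L = {}"
proof (rule ccontr)
  assume ne: "dsupp L \<noteq> {}"
  then have "L \<noteq> (\<lambda>_ _. 0)" by (auto simp: dsupp_def)
  then obtain g where "g \<in> G" "HT ord g \<le> HT ord L" using GB L by (auto simp: is_GB_def)
  moreover have "HT ord L \<in> PT ord G" using HT_in_dsupp(1)[of L] L ne by (auto simp: is_dop_def)
  ultimately show False by (auto simp: PT_def)
qed

text \<open>D-finiteness turns sufficiently many parametric terms into a nonzero element of the
  ideal supported on \<open>PT\<close>.\<close>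

lemma finite_PT: "finite (PT ord G)"
proof (rule ccontr)
  assume inf: "infinite (PT ord G)"
  obtain N where N: "\<And>U. finite U \<Longrightarrow> card U > N \<Longrightarrow>
      (\<exists>c. (\<forall>u\<in>U. is_poly (c u)) \<and> (\<exists>u\<in>U. c u \<noteq> (\<lambda>_. 0)) \<and>
           in_ideal G (\<lambda>v. if v \<in> U then c v else (\<lambda>_. 0)))"
    using D_fin unfolding D_finite_def by blast
  obtain U where U: "U \<subseteq> PT ord G" "finite U" "card U = Suc N"
    using infinite_arbitrarily_large[OF inf] by blast
  then obtain c where c: "\<forall>u\<in>U. is_poly (c u)" "\<exists>u\<in>U. c u \<noteq> (\<lambda>_. 0)"
    "in_ideal G (\<lambda>v. if v \<in> U then c v else (\<lambda>_. 0))"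
    using N[of U] by auto
  let ?L = "\<lambda>v. if v \<in> U then c v else (\<lambda>_. 0)"
  have sub: "dsupp ?L \<subseteq> U" by (auto simp: dsupp_def)
  then have "is_dop ?L" using c(1) U(2) by (auto simp: is_dop_def is_poly_def intro: finite_subset)
  then have "dsupp ?L = {}" using ideal_PT_zero c(3) sub U(1) by blast
  then have "?L u = (\<lambda>_. 0)" for u unfolding dsupp_def by blast
  then show False using c(2) by metis
qed

lemma ordinary_origin_iff: "ordinary_origin ord G \<longleftrightarrow> (\<forall>g\<in>G. hc ord g 0 \<noteq> 0)"
proof
  assume "ordinary_origin ord G"
  then obtain L where L: "\<And>g. g \<in> G \<Longrightarrow> pdvd (hc ord g) L" "L 0 \<noteq> 0"
    by (auto simp: ordinary_origin_def is_plcm_def zero_fun_def)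
  show "\<forall>g\<in>G. hc ord g 0 \<noteq> 0"
  proof
    fix g assume "g \<in> G"
    then obtain k where "Mps L = Mps (hc ord g) * k"
      using L(1) by (auto simp: pdvd_iff dvd_in_def)
    then have "coef (Mps L) 0 = coef (Mps (hc ord g)) 0 * coef k 0"
      using coef_mult_0[of "Mps (hc ord g)" k] by (simp only:)
    then show "hc ord g 0 \<noteq> 0" using L(2) by (auto simp only: coef_Mps mult_zero_left)
  qed
next
  assume ord: "\<forall>g\<in>G. hc ord g 0 \<noteq> 0"
  let ?P = "polys UNIV :: ('v, 'a) mps set"
  let ?H = "(\<lambda>g. Mps (hc ord g)) ` G"
  have "?H \<subseteq> ?P" using hc_G(1) by blast
  moreover have "0 \<notin> ?H" using hc_G(2) by (metis imageE)
  ultimately obtain l where l: "l \<in> ?P" "\<forall>a\<in>?H. dvd_in ?P a l"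
    "\<forall>m\<in>?P. (\<forall>a\<in>?H. dvd_in ?P a m) \<longrightarrow> dvd_in ?P l m"
    using lcm_set_in_exists[OF factorial_in_polys finite_imageI[OF finite_G]] by metis
  have l_alt: "l = Mps (coef l)" by (simp add: coef_inverse)
  have "is_plcm (coef l) (hc ord ` G)"
    unfolding is_plcm_def
  proof (intro conjI allI impI ballI)
    show "is_poly (coef l)" using l(1) by (simp add: polys_UNIV_iff)
    show "pdvd c (coef l)" if "c \<in> hc ord ` G" for c
      using that l(2) l_alt by (auto simp: pdvd_iff)
    show "pdvd (coef l) M" if "is_poly M \<and> (\<forall>c\<in>hc ord ` G. pdvd c M)" for M
      using that l(3)[THEN bspec, of "Mps M"] l_alt by (auto simp: pdvd_iff Mps_in_polys_iff)
  qed
  moreover have "coef l 0 \<noteq> 0"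
  proof
    assume l0: "coef l 0 = 0"
    have fac: "(\<Prod>g\<in>G. Mps (hc ord g)) = Mps (hc ord g) * (\<Prod>g\<in>G - {g}. Mps (hc ord g))" if "g \<in> G" for g
      using that finite_G by (rule prod.remove[rotated])
    \<comment> \<open>The product of the head coefficients is a common multiple with nonzero
      constant term, so no divisor of it vanishes at the origin.\<close>
    have "dvd_in ?P l (\<Prod>g\<in>G. Mps (hc ord g))"
    proof (rule l(3)[rule_format])
      show "(\<Prod>g\<in>G. Mps (hc ord g)) \<in> ?P"
        using hc_G by (intro subring_set_prod subring_set_polys) auto
      show "dvd_in ?P a (\<Prod>g\<in>G. Mps (hc ord g))" if "a \<in> ?H" for a
      proof -
        from that obtain g where g: "g \<in> G" "a = Mps (hc ord g)" by blast
        have "(\<Prod>g\<in>G - {g}. Mps (hc ord g)) \<in> ?P"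
          using hc_G by (intro subring_set_prod subring_set_polys) auto
        then show "dvd_in ?P a (\<Prod>g\<in>G. Mps (hc ord g))" unfolding dvd_in_def g(2) fac[OF g(1)] by blast
      qed
    qed
    then obtain k where "(\<Prod>g\<in>G. Mps (hc ord g)) = l * k" by (auto simp: dvd_in_def)
    then have "(\<Prod>g\<in>G. hc ord g 0) = 0" using l0 coef_prod_0[of "\<lambda>g. Mps (hc ord g)" G] by simp
    then show False using ord finite_G by auto
  qed
  ultimately show "ordinary_origin ord G" unfolding ordinary_origin_def zero_fun_def by blast
qed

lemma ordinary_if_solutions:
  assumes prim: "\<And>g. g \<in> G \<Longrightarrow> primitive g"
    and S: "\<And>f. f \<in> S \<Longrightarrow> f \<noteq> (\<lambda>_. 0) \<and> is_solution G f" "init_exp ord ` S = PT ord G"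
  shows "ordinary_origin ord G"
  unfolding ordinary_origin_iff
proof (intro ballI notI)
  fix P assume P: "P \<in> G" and hc0: "hc ord P 0 = 0"
  let ?A = "PT ord G"
  define f where "f v = (SOME f. f \<in> S \<and> init_exp ord f = v)" for v
  have f: "f v \<in> S \<and> init_exp ord (f v) = v" if v: "v \<in> ?A" for v
  proof -
    have "\<exists>f. f \<in> S \<and> init_exp ord f = v" using v unfolding S(2)[symmetric] by auto
    then show ?thesis unfolding f_def by (rule someI_ex)
  qed
  \<comment> \<open>A generalized Wronskian. Its entries at the origin are u! times the coefficient
    of \<open>f v\<close> at \<open>u\<close>, which is zero below the initial exponent
    \<open>v\<close>; characteristic zero keeps the diagonal nonzero.\<close>
  define W where "W u v = Mps (pderivs u (f v))" for u v
  define h where "h = Mps (hc ord P)"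
  have W0: "coef (W u v) 0 = of_nat (\<Prod>i\<in>UNIV. fact (u i)) * f v u" for u v
    by (simp add: W_def pderivs_def)
  have "h dvd (\<Sum>u\<in>?A. Mps (P u) * W u v)" if v: "v \<in> ?A" for v
  proof -
    have "dapply P (f v) = (\<lambda>_. 0)" using S(1) f[OF v] P by (auto simp: is_solution_def)
    then have "0 = (\<Sum>u\<in>dsupp P. Mps (P u) * W u v)"
      using Mps_dapply[of P "f v"] by (simp add: W_def zero_mps_def)
    \<comment> \<open>By reducedness all terms of \<open>P\<close> except the head term are
      parametric; the head term will supply the multiple of \<open>h\<close>.\<close>
    also have "\<dots> = (\<Sum>u\<in>insert (HT ord P) ?A. Mps (P u) * W u v)"
      using dsupp_subset[OF P] finite_PT by (intro sum.mono_neutral_left) (auto simp: dsupp_iff)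
    also have "\<dots> = h * W (HT ord P) v + (\<Sum>u\<in>?A. Mps (P u) * W u v)"
      using HT_notin_PT[OF P] finite_PT by (simp add: h_def hc_def)
    finally have "(\<Sum>u\<in>?A. Mps (P u) * W u v) = h * (- W (HT ord P) v)"
      by (simp add: eq_neg_iff_add_eq_0 add.commute)
    then show ?thesis by simp
  qed
  moreover have "coef (W v v) 0 \<noteq> 0" if v: "v \<in> ?A" for v
    using init_exp_props(1)[of "f v"] f[OF v] S(1) by (auto simp: W0)
  moreover have "coef (W u v) 0 = 0" if "u \<in> ?A" "v \<in> ?A" "ord u v" for u v
    using init_exp_props(2)[of "f v" u] f[OF that(2)] S(1) that(3) by (auto simp: W0)
  ultimately have hdvd: "\<forall>u\<in>?A. h dvd Mps (P u)"
    by (rule dvd_of_triangular_system[OF finite_PT, where W = W])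
  have "prime_product (polys UNIV) h"
    using factorial_in_polys[of UNIV] hc_G[OF P] by (auto simp: factorial_in_def h_def)
  moreover have "coef h 0 = 0" using hc0 by (simp add: h_def)
  ultimately obtain p where p: "prime_in (polys UNIV) p" "coef p 0 = 0" "dvd_in (polys UNIV) p h"
    using prime_factor_vanishing_at_0[OF _ subring_set_polys] by blast
  have "dvd_in (polys UNIV) p (Mps (P u))" if u: "u \<in> dsupp P" for u
  proof (cases "u = HT ord P")
    case True
    then show ?thesis using p(3) by (simp add: h_def hc_def)
  next
    case False
    then have "h dvd Mps (P u)" using hdvd dsupp_subset[OF P] u by blast
    then obtain s where "Mps (P u) = h * s" by (rule dvdE)
    moreover obtain k where "h = p * k" using p(3) by (auto simp: dvd_in_def)
    ultimately have "Mps (P u) = p * (k * s)" by (simp only: mult.assoc)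
    then show ?thesis using prime_dvd_of_series_dvd[OF p(1,2) is_dop_Mps[OF dop[OF P]]] by blast
  qed
  then have "\<forall>u\<in>dsupp P. pdvd (coef p) (P u)" by (simp add: pdvd_iff coef_inverse)
  moreover have "is_poly (coef p)" using p(1) by (simp add: prime_in_def polys_UNIV_iff)
  ultimately have "coef p (\<lambda>_. 0) \<noteq> 0" using prim[OF P] unfolding primitive_def by blast
  then show False using p(2) by (simp flip: zero_fun_def)
qed

end

section \<open>From ordinary points to solutions\<close>

definition mfact :: "'v::finite mon \<Rightarrow> nat" where
  "mfact w = (\<Prod>i\<in>UNIV. fact (w i))"

lemma mfact_pos: "mfact w > 0"
  by (simp add: mfact_def prod_pos)

lemma mfact_mbinom: "k \<le> v \<Longrightarrow> mfact k * mfact (v - k) * mbinom v k = mfact v"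
  unfolding mbinom_def mfact_def prod.distrib[symmetric]
  by (intro prod.cong) (simp_all add: le_fun_def binomial_fact_lemma)

lemma pderivs_factor: "(\<Prod>i\<in>UNIV. fact (w i + k i) div fact (w i)) * mfact w = mfact (w + k)"
  unfolding mfact_def prod.distrib[symmetric]
  by (intro prod.cong) (auto intro!: dvd_div_mult_self fact_dvd)

lemma coef_pderivs_0: "coef (Mps (pderivs k c)) 0 = of_nat (mfact k) * c k"
  by (simp add: pderivs_def mfact_def)

lemma is_poly_pderivs:
  assumes "is_poly c"
  shows "is_poly (pderivs k c)"
proof -
  have "{w. pderivs k c w \<noteq> 0} \<subseteq> (\<lambda>w. w + k) -` {w. c w \<noteq> 0}"
    by (auto simp: pderivs_def plus_fun_def)
  moreover have "finite ((\<lambda>w. w + k) -` {w. c w \<noteq> 0})"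
    using assms unfolding is_poly_def by (intro finite_vimageI) (auto simp: inj_on_def)
  ultimately show ?thesis unfolding is_poly_def by (rule finite_subset)
qed

text \<open>The coefficients of \<open>\<partial>\<^sup>v g\<close>.\<close>

definition dshift :: "'v::finite mon \<Rightarrow> ('v, 'a::comm_ring_1) dop \<Rightarrow> 'v mon \<Rightarrow> ('v, 'a) mps" where
  "dshift v g w = (\<Sum>k | k \<le> v \<and> v - k \<le> w. of_nat (mbinom v k) * Mps (pderivs k (g (w - (v - k)))))"

lemma Mps_dmul: "Mps (dmul P R w) = (\<Sum>u\<in>dsupp P. Mps (P u) * dshift u R w)"
proof (rule mps_eqI)
  fix x
  have "coef (Mps (P u) * dshift u R w) x =
    (\<Sum>k | k \<le> u \<and> u - k \<le> w. of_nat (mbinom u k) * pmul (P u) (pderivs k (R (w - (u - k)))) x)" for u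
  proof -
    have "Mps (P u) * dshift u R w = (\<Sum>k | k \<le> u \<and> u - k \<le> w.
        of_nat (mbinom u k) * Mps (pmul (P u) (pderivs k (R (w - (u - k))))))"
      unfolding dshift_def sum_distrib_left Mps_pmul by (simp only: mult.left_commute)
    then show ?thesis by (simp add: coef_of_nat_mult)
  qed
  then show "coef (Mps (dmul P R w)) x = coef (\<Sum>u\<in>dsupp P. Mps (P u) * dshift u R w) x"
    by (simp add: dmul_def fun_diff_def)
qed

lemma subring_set_of_nat: "subring_set R \<Longrightarrow> of_nat n \<in> R"
  by (induction n) (auto intro: subring_setD)

lemma dshift_in_polys: "is_dop g \<Longrightarrow> dshift v g w \<in> polys UNIV"
  unfolding dshift_def
  by (intro subring_set_sum subring_setD(5) subring_set_of_nat subring_set_polys)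
    (simp add: Mps_in_polys_iff is_poly_pderivs is_dop_def)

lemma dshift_nonzeroE:
  assumes "dshift v g w \<noteq> 0"
  obtains k u where "k \<le> v" "u \<in> dsupp g" "w = (v - k) + u"
proof -
  obtain k where k: "k \<le> v" "v - k \<le> w" "of_nat (mbinom v k) * Mps (pderivs k (g (w - (v - k)))) \<noteq> 0"
    using assms unfolding dshift_def by (metis (mono_tags, lifting) mem_Collect_eq sum.neutral)
  have "w - (v - k) \<in> dsupp g"
  proof (rule ccontr)
    assume "w - (v - k) \<notin> dsupp g"
    then have "pderivs k (g (w - (v - k))) = (\<lambda>_. 0)" by (auto simp: dsupp_def pderivs_def)
    then show False using k(3) Mps_eq_0_iff by (metis mult_zero_right)
  qed
  then show ?thesis using that[OF k(1)] mon_le_add_diff[OF k(2)] by metis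
qed

text \<open>The local ring of K[x] at the origin, embedded in K[[x]]. Its elements have a value at
  the origin, namely their constant term, and their denominators can be cleared to return to
  \<open>in_ideal\<close>.\<close>

definition loc_polys :: "('v::finite, 'a::field) mps set" where
  "loc_polys = {s. \<exists>q\<in>polys UNIV. coef q 0 \<noteq> 0 \<and> q * s \<in> polys UNIV}"

lemma loc_polysI: "q \<in> polys UNIV \<Longrightarrow> coef q 0 \<noteq> 0 \<Longrightarrow> q * s \<in> polys UNIV \<Longrightarrow> s \<in> loc_polys"
  unfolding loc_polys_def by blast

lemma polys_subset_loc: "s \<in> polys UNIV \<Longrightarrow> s \<in> loc_polys"
  by (rule loc_polysI[of 1]) (auto intro: subring_setD subring_set_polys)

lemma subring_set_loc_polys: "subring_set (loc_polys :: ('v::finite, 'a::field) mps set)"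
proof -
  note P = subring_setD[OF subring_set_polys[of UNIV]]
  have "s + t \<in> loc_polys \<and> s - t \<in> loc_polys \<and> s * t \<in> loc_polys"
    if s: "s \<in> loc_polys" and t: "t \<in> loc_polys" for s t :: "('v, 'a) mps"
  proof -
    obtain q where q: "q \<in> polys UNIV" "coef q 0 \<noteq> 0" "q * s \<in> polys UNIV"
      using s by (auto simp: loc_polys_def)
    obtain r where r: "r \<in> polys UNIV" "coef r 0 \<noteq> 0" "r * t \<in> polys UNIV"
      using t by (auto simp: loc_polys_def)
    have "q * r * (s + t) = r * (q * s) + q * (r * t)" "q * r * (s - t) = r * (q * s) - q * (r * t)"
      "q * r * (s * t) = (q * s) * (r * t)"
      by (simp_all only: algebra_simps)
    then have "q * r * (s + t) \<in> polys UNIV" "q * r * (s - t) \<in> polys UNIV" "q * r * (s * t) \<in> polys UNIV"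
      using P q r by metis+
    moreover have "q * r \<in> polys UNIV" "coef (q * r) 0 \<noteq> 0" using P q r by auto
    ultimately show ?thesis using loc_polysI by blast
  qed
  moreover have "(0 :: ('v, 'a) mps) \<in> loc_polys" "(1 :: ('v, 'a) mps) \<in> loc_polys"
    by (rule polys_subset_loc[OF P(1)] polys_subset_loc[OF P(2)])+
  ultimately show ?thesis unfolding subring_set_def by simp
qed

text \<open>The left ideal generated by \<open>G\<close> in the operators with coefficients in
  \<open>R\<close>, as combinations of the \<open>\<partial>\<^sup>v g\<close> with coefficients on
  the left. Membership thus needs no multiplication of operators with non-polynomial
  coefficients.\<close>

inductive_set dspan :: "('v::finite, 'a::comm_ring_1) mps set \<Rightarrow> ('v, 'a) dop set \<Rightarrow> ('v mon \<Rightarrow> ('v, 'a) mps) set"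
  for R G where
  zero: "(\<lambda>_. 0) \<in> dspan R G"
| step: "L \<in> dspan R G \<Longrightarrow> c \<in> R \<Longrightarrow> g \<in> G \<Longrightarrow> (\<lambda>w. L w + c * dshift v g w) \<in> dspan R G"

lemma dspan_add:
  assumes "L \<in> dspan R G" "L' \<in> dspan R G"
  shows "(\<lambda>w. L w + L' w) \<in> dspan R G"
  using assms(2)
proof induction
  case zero
  then show ?case using assms(1) by simp
next
  case (step L' c g v)
  then show ?case using dspan.step[OF step.IH, of c g v] by (simp add: add.assoc)
qed

lemma dspan_scale:
  assumes "subring_set R" "c \<in> R" "L \<in> dspan R G"
  shows "(\<lambda>w. c * L w) \<in> dspan R G"
  using assms(3)
proof induction
  case zero
  then show ?case by (simp add: dspan.zero)
next
  case (step L d g v)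
  then show ?case
    using dspan.step[OF step.IH, of "c * d" g v] subring_setD(5)[OF assms(1,2)]
    by (simp add: distrib_left mult.assoc)
qed

lemma dspan_gen: "subring_set R \<Longrightarrow> g \<in> G \<Longrightarrow> dshift v g \<in> dspan R G"
  using dspan.step[OF dspan.zero, of 1 R g G v] by (simp add: subring_setD(2))

lemma dspan_diff:
  assumes "subring_set R" "L \<in> dspan R G" "L' \<in> dspan R G"
  shows "(\<lambda>w. L w - L' w) \<in> dspan R G"
  using dspan_add[OF assms(2) dspan_scale[OF assms(1) _ assms(3)], of "- 1"]
    subring_set_uminus[OF assms(1) subring_setD(2)[OF assms(1)]] by simp

lemma dspan_sum: "(\<And>i. i \<in> I \<Longrightarrow> L i \<in> dspan R G) \<Longrightarrow> (\<lambda>w. \<Sum>i\<in>I. L i w) \<in> dspan R G"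
proof (induction I rule: infinite_finite_induct)
  case (insert i I)
  then have "L i \<in> dspan R G" "(\<lambda>w. \<Sum>i\<in>I. L i w) \<in> dspan R G" by auto
  from dspan_add[OF this] show ?case using insert.hyps by simp
qed (auto simp: dspan.zero)

lemma dspan_polys_in_polys:
  assumes "\<And>g. g \<in> G \<Longrightarrow> is_dop g" "L \<in> dspan (polys UNIV) G"
  shows "L w \<in> polys UNIV"
  using assms(2)
proof induction
  case zero
  then show ?case using subring_setD(1)[OF subring_set_polys] by blast
next
  case (step L c g v)
  then show ?case using assms(1) dshift_in_polys
    by (intro subring_setD(3,5)[OF subring_set_polys]) auto
qed

lemma dspan_polys_combination:
  fixes G :: "('v::finite, 'a::comm_ring_1) dop set"
  assumes "finite G" "L \<in> dspan (polys UNIV) G"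
  shows "\<exists>Q. (\<forall>g\<in>G. is_dop (Q g)) \<and>
    (\<forall>w. L w = (\<Sum>g\<in>G. \<Sum>u\<in>dsupp (Q g). Mps (Q g u) * dshift u g w))"
  using assms(2)
proof induction
  case zero
  have "dsupp (\<lambda>_ _. 0 :: 'a) = ({} :: 'v mon set)" by (auto simp: dsupp_def)
  then show ?case by (intro exI[of _ "\<lambda>_ _ _. 0"]) (auto simp: is_dop_def is_poly_def)
next
  case (step L c g v)
  then obtain Q where Q: "\<And>g. g \<in> G \<Longrightarrow> is_dop (Q g)"
    "\<And>w. L w = (\<Sum>g\<in>G. \<Sum>u\<in>dsupp (Q g). Mps (Q g u) * dshift u g w)" by blast
  define q where "q = (Q g)(v := coef (Mps (Q g v) + c))"
  define Q' where "Q' = Q(g := q)"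
  \<comment> \<open>Adding \<open>c\<close> at \<open>v\<close> may create or cancel a term of the
    multiplier, so both supports are compared inside a common finite set.\<close>
  define X where "X = insert v (dsupp (Q g))"
  have fin: "finite X" using Q(1)[OF step.hyps(3)] by (simp add: X_def is_dop_def)
  have q_Mps: "Mps (q u) = Mps (Q g u) + (if u = v then c else 0)" for u
    by (simp add: q_def coef_inverse)
  have sub: "dsupp q \<subseteq> X" by (auto simp: X_def dsupp_iff q_Mps split: if_splits)
  have "Mps (q u) \<in> polys UNIV" for u
    unfolding q_Mps using is_dop_Mps[OF Q(1)[OF step.hyps(3)]] step.hyps(2) subring_set_polys
    by (auto intro!: subring_setD)
  then have "is_dop q" using sub fin by (auto simp: is_dop_def Mps_in_polys_iff intro: finite_subset)
  then have "\<forall>g\<in>G. is_dop (Q' g)" using Q(1) by (simp add: Q'_def)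
  moreover have "L w + c * dshift v g w = (\<Sum>g\<in>G. \<Sum>u\<in>dsupp (Q' g). Mps (Q' g u) * dshift u g w)" for w
  proof -
    have "(\<Sum>u\<in>dsupp q. Mps (q u) * dshift u g w) = (\<Sum>u\<in>X. Mps (q u) * dshift u g w)"
      using sub fin by (intro sum.mono_neutral_left) (auto simp: dsupp_iff)
    also have "\<dots> = (\<Sum>u\<in>X. Mps (Q g u) * dshift u g w + (if u = v then c * dshift v g w else 0))"
      unfolding q_Mps by (intro sum.cong refl) (auto simp: distrib_right)
    also have "\<dots> = (\<Sum>u\<in>X. Mps (Q g u) * dshift u g w) + c * dshift v g w"
      using fin by (simp add: sum.distrib X_def)
    also have "(\<Sum>u\<in>X. Mps (Q g u) * dshift u g w) = (\<Sum>u\<in>dsupp (Q g). Mps (Q g u) * dshift u g w)"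
      using fin by (intro sum.mono_neutral_right) (auto simp: X_def dsupp_iff)
    finally have q_sum: "(\<Sum>u\<in>dsupp q. Mps (q u) * dshift u g w) =
      (\<Sum>u\<in>dsupp (Q g). Mps (Q g u) * dshift u g w) + c * dshift v g w" .
    have "(\<Sum>h\<in>G. \<Sum>u\<in>dsupp (Q' h). Mps (Q' h u) * dshift u h w) =
      (\<Sum>h\<in>G. (\<Sum>u\<in>dsupp (Q h). Mps (Q h u) * dshift u h w) + (if h = g then c * dshift v g w else 0))"
      by (intro sum.cong refl) (auto simp: Q'_def q_sum)
    also have "\<dots> = L w + c * dshift v g w"
      unfolding sum.distrib Q(2)[symmetric] using assms(1) step.hyps(3) by simp
    finally show ?thesis by simp
  qed
  ultimately show ?case by blast
qed

lemma dspan_polys_in_ideal: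
  fixes G :: "('v::finite, 'a::comm_ring_1) dop set"
  assumes "finite G" "L \<in> dspan (polys UNIV) G"
  shows "in_ideal G (\<lambda>u. coef (L u))"
proof -
  obtain Q where Q: "\<forall>g\<in>G. is_dop (Q g)"
    "\<And>w. L w = (\<Sum>g\<in>G. \<Sum>u\<in>dsupp (Q g). Mps (Q g u) * dshift u g w)"
    using dspan_polys_combination[OF assms] by blast
  have "pmul (coef 1) (coef (L u)) x = (\<Sum>g\<in>G. dmul (Q g) g u x)" for u x
  proof -
    have "pmul (coef 1) (coef (L u)) = coef (L u)"
      using Mps_pmul[of "coef 1" "coef (L u)"] by (metis coef_Mps coef_inverse mult_1)
    moreover have "L u = (\<Sum>g\<in>G. Mps (dmul (Q g) g u))" unfolding Q(2) Mps_dmul ..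
    ultimately show ?thesis by simp
  qed
  then have "dlmul (coef 1) (\<lambda>u. coef (L u)) = (\<lambda>u x. \<Sum>g\<in>G. dmul (Q g) g u x)"
    unfolding dlmul_def by blast
  moreover have "is_poly (coef (1 :: ('v, 'a) mps))"
    using subring_setD(2)[OF subring_set_polys] by (metis polys_UNIV_iff)
  moreover have "coef (1 :: ('v, 'a) mps) \<noteq> (\<lambda>_. 0)"
    by (metis coef_simps(2) zero_neq_one)
  ultimately show ?thesis unfolding in_ideal_def using Q(1) by blast
qed

text \<open>The denominators multiply up to a polynomial that still has nonzero constant term, in
  particular a nonzero one.\<close>

lemma dspan_loc_clear_denominator:
  assumes "L \<in> dspan loc_polys G"
  shows "\<exists>q\<in>polys UNIV. coef q 0 \<noteq> 0 \<and> (\<lambda>w. q * L w) \<in> dspan (polys UNIV) G"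
  using assms
proof induction
  case zero
  have "coef (1 :: ('a, 'b) mps) 0 \<noteq> 0" by simp
  then show ?case using subring_setD(2)[OF subring_set_polys] dspan.zero by (metis mult_zero_right)
next
  case (step L c g v)
  note P = subring_set_polys[of UNIV]
  obtain q where q: "q \<in> polys UNIV" "coef q 0 \<noteq> 0" "(\<lambda>w. q * L w) \<in> dspan (polys UNIV) G"
    using step.IH by blast
  obtain r where r: "r \<in> polys UNIV" "coef r 0 \<noteq> 0" "r * c \<in> polys UNIV"
    using step.hyps by (auto simp: loc_polys_def)
  have "(\<lambda>w. r * (q * L w) + q * (r * c) * dshift v g w) \<in> dspan (polys UNIV) G"
    by (intro dspan.step[OF dspan_scale[OF P r(1) q(3)]] subring_setD(5)[OF P] q(1) r(3) step.hyps(3))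
  then have "(\<lambda>w. (r * q) * (L w + c * dshift v g w)) \<in> dspan (polys UNIV) G"
    by (simp add: algebra_simps)
  moreover have "r * q \<in> polys UNIV" "coef (r * q) 0 \<noteq> 0"
    using q r subring_setD(5)[OF P] by auto
  ultimately show ?case by blast
qed

section \<open>Taylor coefficients of \<open>P f\<close>\<close>

lemma coef_dshift_0:
  fixes g :: "('v::finite, 'a::comm_ring_1) dop"
  shows "coef (dshift v g w) 0 =
    (\<Sum>k | k \<le> v \<and> v - k \<le> w. of_nat (mbinom v k * mfact k) * g (w - (v - k)) k)"
  unfolding dshift_def coef_sum coef_of_nat_mult coef_pderivs_0
  by (simp only: of_nat_mult mult.assoc)

text \<open>Both sides are the value at the origin of \<open>\<partial>\<^sup>v\<close> applied to
  \<open>P f\<close>: on the left through the Taylor coefficient, on the right by expanding the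
  operator \<open>\<partial>\<^sup>v P\<close>. The number \<open>c w\<close> is the derivative of
  \<open>f\<close> of order \<open>w\<close> at the origin.\<close>

lemma mfact_dapply:
  fixes P :: "('v::finite, 'a::field_char_0) dop" and c :: "'v mon \<Rightarrow> 'a"
  defines "f \<equiv> \<lambda>w. c w / of_nat (mfact w)"
  assumes P: "is_dop P" and X: "finite X" "{w. dshift v P w \<noteq> 0} \<subseteq> X"
  shows "of_nat (mfact v) * dapply P f v = (\<Sum>w\<in>X. coef (dshift v P w) 0 * c w)"
proof -
  have finP: "finite (dsupp P)" using P by (simp add: is_dop_def)
  \<comment> \<open>The Leibniz term in which \<open>k\<close> of the \<open>v\<close> derivatives
    fall on the coefficient \<open>P u\<close> and the rest on the series.\<close>
  define t where "t k u = of_nat (mbinom v k * mfact k) * P u k * c ((v - k) + u)" for k u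
  have "of_nat (mfact v) * pmul (P u) (pderivs u f) v = (\<Sum>k | k \<le> v. t k u)" for u
  proof -
    have "of_nat (mfact v) * (P u k * pderivs u f (v - k)) = t k u" if "k \<le> v" for k
    proof -
      define m where "m = v - k"
      define n where "n = (\<Prod>i\<in>UNIV. fact (m i + u i) div fact (m i) :: nat)"
      define y where "y = c (m + u)"
      have n: "n * mfact m = mfact (m + u)" unfolding n_def by (rule pderivs_factor)
      have "n \<noteq> 0" "mfact m \<noteq> 0"
        using n mfact_pos[of m] mfact_pos[of "m + u"] by (metis mult_zero_left less_irrefl)+
      moreover have "pderivs u f m = of_nat n * (y / of_nat (n * mfact m))"
        by (simp only: n) (simp only: pderivs_def f_def y_def n_def plus_fun_def)
      ultimately have "of_nat (mfact m) * pderivs u f m = y" by simp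
      moreover have "(of_nat (mfact v) :: 'a) = of_nat (mbinom v k * mfact k) * of_nat (mfact m)"
        unfolding m_def mfact_mbinom[OF that, symmetric] of_nat_mult by (simp only: ac_simps)
      ultimately show ?thesis unfolding t_def m_def[symmetric] y_def[symmetric] by (simp add: ac_simps)
    qed
    moreover have "pmul (P u) (pderivs u f) v = (\<Sum>k | k \<le> v. P u k * pderivs u f (v - k))"
      by (simp add: pmul_def fun_diff_def)
    ultimately show ?thesis by (simp add: sum_distrib_left)
  qed
  then have "of_nat (mfact v) * dapply P f v = (\<Sum>u\<in>dsupp P. \<Sum>k | k \<le> v. t k u)"
    unfolding dapply_def sum_distrib_left by simp
  also have "\<dots> = (\<Sum>k | k \<le> v. \<Sum>u\<in>dsupp P. t k u)" by (rule sum.swap)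
  finally have lhs: "of_nat (mfact v) * dapply P f v = (\<Sum>k | k \<le> v. \<Sum>u\<in>dsupp P. t k u)" .
  \<comment> \<open>Leibniz terms may cancel at an index, which \<open>X\<close> is then free to
    omit. \<open>Y\<close> contains every index that a single term reaches, so the two sums can be
    swapped and reindexed.\<close>
  define Y where "Y = X \<union> (\<lambda>(k, u). (v - k) + u) ` ({k. k \<le> v} \<times> dsupp P)"
  have finY: "finite Y" using X(1) finP by (simp add: Y_def)
  have "(\<Sum>w\<in>X. coef (dshift v P w) 0 * c w) = (\<Sum>w\<in>Y. coef (dshift v P w) 0 * c w)"
  proof (intro sum.mono_neutral_left[OF finY] ballI)
    fix w assume "w \<in> Y - X"
    then have "dshift v P w = 0" using X(2) by blast
    then show "coef (dshift v P w) 0 * c w = 0" by simp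
  qed (simp add: Y_def)
  also have "\<dots> = (\<Sum>w\<in>Y. \<Sum>k | k \<le> v. if v - k \<le> w then t k (w - (v - k)) else 0)"
  proof (rule sum.cong[OF refl])
    fix w
    have "coef (dshift v P w) 0 * c w = (\<Sum>k | k \<le> v \<and> v - k \<le> w. t k (w - (v - k)))"
      unfolding coef_dshift_0 sum_distrib_right t_def by (intro sum.cong refl) (auto simp: mon_le_add_diff)
    also have "\<dots> = (\<Sum>k\<in>{k. k \<le> v} \<inter> {k. v - k \<le> w}. t k (w - (v - k)))"
      by (intro sum.cong) auto
    also have "\<dots> = (\<Sum>k | k \<le> v. if v - k \<le> w then t k (w - (v - k)) else 0)"
      by (simp add: sum.inter_restrict)
    finally show "coef (dshift v P w) 0 * c w = \<dots>" .
  qed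
  also have "\<dots> = (\<Sum>k | k \<le> v. \<Sum>w\<in>Y. if v - k \<le> w then t k (w - (v - k)) else 0)"
    by (rule sum.swap)
  also have "\<dots> = (\<Sum>k | k \<le> v. \<Sum>u\<in>dsupp P. t k u)"
  proof (rule sum.cong[OF refl])
    fix k assume k: "k \<in> {k. k \<le> v}"
    let ?i = "\<lambda>u. (v - k) + u"
    have "?i ` dsupp P \<subseteq> Y" using k by (auto simp: Y_def)
    then have "(\<Sum>w\<in>Y. if v - k \<le> w then t k (w - (v - k)) else 0) =
        (\<Sum>w\<in>?i ` dsupp P. if v - k \<le> w then t k (w - (v - k)) else 0)"
    proof (intro sum.mono_neutral_right[OF finY] ballI)
      fix w assume w: "w \<in> Y - ?i ` dsupp P"
      show "(if v - k \<le> w then t k (w - (v - k)) else 0) = 0"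
      proof (cases "v - k \<le> w")
        case True
        then have "w - (v - k) \<notin> dsupp P" using w mon_le_add_diff[OF True] by (metis DiffD2 image_eqI)
        then show ?thesis by (simp add: dsupp_def t_def)
      qed simp
    qed
    also have "\<dots> = (\<Sum>u\<in>dsupp P. t k u)"
      by (subst sum.reindex) (auto simp: inj_on_def)
    finally show "(\<Sum>w\<in>Y. if v - k \<le> w then t k (w - (v - k)) else 0) = (\<Sum>u\<in>dsupp P. t k u)" .
  qed
  finally show ?thesis using lhs by simp
qed

section \<open>Normal forms and the dual basis of solutions\<close>

context groebner_basis
begin

text \<open>A derivative spent on a coefficient lowers the exponent of \<open>\<partial>\<close>,
  and a term of \<open>g\<close> other than its head lies lower as well; additivity of the order
  preserves both losses.\<close>

lemma dshift_below:
  assumes g: "g \<in> G" and w: "dshift v g w \<noteq> 0" "w \<noteq> v + HT ord g"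
  shows "ord w (v + HT ord g)"
proof -
  obtain k u where k: "k \<le> v" "u \<in> dsupp g" "w = (v - k) + u" using dshift_nonzeroE[OF w(1)] .
  let ?h = "HT ord g"
  have v: "(v - k) + ?h + k = v + ?h" by (rule mon_diff_add[OF k(1)])
  have le: "(v - k) + ?h = v + ?h \<or> ord ((v - k) + ?h) (v + ?h)"
  proof (cases "k = 0")
    case False
    then show ?thesis using ord_add_right_pos[of k "(v - k) + ?h"] v by simp
  qed (use v in simp)
  show ?thesis
  proof (cases "u = ?h")
    case True
    then show ?thesis using le w(2) k(3) by blast
  next
    case False
    then have "ord w ((v - k) + ?h)" using HT_G(2)[OF g k(2)] ord_add_left k(3) by blast
    then show ?thesis using le ord_trans by metis
  qed
qed

lemma dshift_leading:
  assumes g: "g \<in> G"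
  shows "dshift v g (v + HT ord g) = Mps (hc ord g)"
proof -
  let ?h = "HT ord g"
  have idx: "v + ?h - (v - k) = ?h + k" if "k \<le> v" for k
    using mon_add_diff(1)[of "v - k" "?h + k"] mon_diff_add[OF that, of ?h] by (simp only: add.assoc)
  have "of_nat (mbinom v k) * Mps (pderivs k (g (v + ?h - (v - k)))) =
      (if k = 0 then Mps (hc ord g) else 0)" if k: "k \<le> v" for k
  proof (cases "k = 0")
    case True
    have "pderivs 0 c = c" for c :: "('v, 'a) ser"
      unfolding pderivs_def by (auto simp: fun_eq_iff)
    then show ?thesis using True by (simp add: idx[OF k] mbinom_def hc_def)
  next
    case False
    then have "?h + k \<notin> dsupp g"
      using HT_G(2)[OF g] ord_add_right_pos[OF False] ord_antisym ord_irrefl by metis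
    then have "pderivs k (g (?h + k)) = (\<lambda>_. 0)" by (auto simp: dsupp_def pderivs_def)
    then show ?thesis using False idx[OF k] Mps_eq_0_iff by (metis mult_zero_right)
  qed
  then have "dshift v g (v + ?h) =
      (\<Sum>k | k \<le> v \<and> v - k \<le> v + ?h. if k = 0 then Mps (hc ord g) else 0)"
    unfolding dshift_def by (intro sum.cong) auto
  also have "\<dots> = Mps (hc ord g)"
    by (subst sum.delta) (auto intro: finite_subset[OF _ finite_mon_le[of v]])
  finally show ?thesis .
qed

lemma finite_dshift_support:
  assumes "g \<in> G"
  shows "finite {w. dshift v g w \<noteq> 0}"
  by (rule finite_subset[of _ "insert (v + HT ord g) {w. ord w (v + HT ord g)}"])
    (use dshift_below[OF assms] finite_ord_below in auto)

text \<open>Multiplying by a common denominator does not change the support, so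
  \<open>ideal_PT_zero\<close> applies over the polynomials.\<close>

lemma dspan_PT_zero:
  assumes L: "L \<in> dspan loc_polys G" and sub: "\<And>w. L w \<noteq> 0 \<Longrightarrow> w \<in> PT ord G"
  shows "L w = 0"
proof -
  obtain q where q: "q \<in> polys UNIV" "coef q 0 \<noteq> 0" "(\<lambda>w. q * L w) \<in> dspan (polys UNIV) G"
    using dspan_loc_clear_denominator[OF L] by blast
  let ?L = "\<lambda>u. coef (q * L u)"
  have ds: "u \<in> dsupp ?L \<longleftrightarrow> q * L u \<noteq> 0" for u by (simp add: dsupp_iff coef_inverse)
  have PT: "dsupp ?L \<subseteq> PT ord G" using sub by (auto simp: ds)
  have "is_poly (?L u)" for u
    using dspan_polys_in_polys[OF dop q(3), of u] by (simp add: polys_UNIV_iff)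
  then have "is_dop ?L" using finite_subset[OF PT finite_PT] by (simp add: is_dop_def)
  then have "dsupp ?L = {}"
    using ideal_PT_zero dspan_polys_in_ideal[OF finite_G q(3)] PT by blast
  then have "q * L w = 0" using ds by blast
  moreover have "q \<noteq> 0" using q(2) by auto
  ultimately show ?thesis by simp
qed

text \<open>\<open>r\<close> is the remainder of \<open>\<partial>\<^sup>w\<close> modulo \<open>G\<close>, computed with coefficients that have no pole at the origin.\<close>

definition normal_form :: "'v mon \<Rightarrow> ('v mon \<Rightarrow> ('v, 'a) mps) \<Rightarrow> bool" where
  "normal_form w r \<longleftrightarrow> (\<forall>u. r u \<noteq> 0 \<longrightarrow> u \<in> PT ord G \<and> (u = w \<or> ord u w)) \<and>
    (\<lambda>u. (if u = w then 1 else 0) - r u) \<in> dspan loc_polys G"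

lemma normal_form_PT: "w \<in> PT ord G \<Longrightarrow> normal_form w (\<lambda>u. if u = w then 1 else 0)"
  using dspan.zero[of loc_polys G] by (simp add: normal_form_def)

text \<open>The head term of \<open>\<partial>\<^sup>v g\<close> is rewritten into smaller terms,
  whose remainders exist by induction. The only division is by the head coefficient of
  \<open>g\<close>, which is invertible in \<open>loc_polys\<close>.\<close>

lemma normal_form_exists:
  assumes ordinary: "\<forall>g\<in>G. hc ord g 0 \<noteq> 0"
  shows "\<exists>r. normal_form w r"
proof (induction w rule: ord_induct)
  case (1 w)
  note S = subring_set_loc_polys
  show ?case
  proof (cases "w \<in> PT ord G")
    case True
    then show ?thesis using normal_form_PT by blast
  next
    case False
    then obtain g where g: "g \<in> G" "HT ord g \<le> w" by (auto simp: PT_def)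
    define v where "v = w - HT ord g"
    have w: "w = v + HT ord g" using mon_le_add_diff[OF g(2)] by (simp add: v_def add.commute)
    define D where "D = dshift v g"
    define X where "X = {u. ord u w}"
    have finX: "finite X" using finite_ord_below by (simp add: X_def)
    have D0: "D u = 0" if "u \<noteq> w" "u \<notin> X" for u
      using dshift_below[OF g(1), of v u] that w by (auto simp: D_def X_def)
    have Dw: "D w = Mps (hc ord g)" using dshift_leading[OF g(1)] by (simp add: D_def w)
    have Dpoly: "D u \<in> polys UNIV" for u unfolding D_def by (rule dshift_in_polys[OF dop[OF g(1)]])
    have "coef (D w) 0 \<noteq> 0" using ordinary g(1) by (simp add: Dw)
    then obtain e where e: "D w * e = 1" using mps_unit by metis
    \<comment> \<open>\<open>D w\<close> is itself an admissible denominator for its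
      inverse.\<close>
    have eloc: "e \<in> loc_polys"
      using loc_polysI[OF Dpoly \<open>coef (D w) 0 \<noteq> 0\<close>] e subring_setD(2)[OF subring_set_polys] by metis
    define \<delta> :: "'v mon \<Rightarrow> 'v mon \<Rightarrow> ('v, 'a) mps" where "\<delta> x u = (if u = x then 1 else 0)" for x u
    have "\<forall>x\<in>X. \<exists>r. normal_form x r" using "1.IH" by (simp add: X_def)
    then obtain r where nf: "\<forall>x\<in>X. normal_form x (r x)" using bchoice by metis
    have r: "u \<in> PT ord G \<and> (u = x \<or> ord u x)" if "x \<in> X" "r x u \<noteq> 0" for x u
      using nf that unfolding normal_form_def by blast
    have r_span: "(\<lambda>u. \<delta> x u - r x u) \<in> dspan loc_polys G" if "x \<in> X" for x
      using nf that unfolding normal_form_def \<delta>_def by blast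
    \<comment> \<open>Modulo the ideal, \<open>\<partial>\<^sup>w\<close> equals the negated sum of
      \<open>e * D x\<close> times \<open>\<partial>\<^sup>x\<close> over the smaller
      \<open>x\<close>; each \<open>\<partial>\<^sup>x\<close> is replaced by its remainder.\<close>
    define s where "s u = - (\<Sum>x\<in>X. e * D x * r x u)" for u
    have "\<delta> w u - s u = e * D u - (\<Sum>x\<in>X. e * D x * (\<delta> x u - r x u))" for u
    proof -
      have "(\<Sum>x\<in>X. e * D x * \<delta> x u) = (\<Sum>x\<in>X. if x = u then e * D u else 0)"
        by (intro sum.cong) (auto simp: \<delta>_def)
      also have "\<dots> = (if u \<in> X then e * D u else 0)" using finX by simp
      also have "\<dots> = e * D u - \<delta> w u"
        using e D0[of u] ord_irrefl[of w] by (auto simp: \<delta>_def X_def mult.commute)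
      finally show ?thesis
        unfolding s_def right_diff_distrib sum_subtractf by simp
    qed
    moreover have "(\<lambda>u. e * D u - (\<Sum>x\<in>X. e * D x * (\<delta> x u - r x u))) \<in> dspan loc_polys G"
    proof (intro dspan_diff[OF S] dspan_sum)
      show "(\<lambda>u. e * D u) \<in> dspan loc_polys G"
        unfolding D_def by (intro dspan_scale[OF S eloc] dspan_gen[OF S g(1)])
      show "(\<lambda>u. e * D x * (\<delta> x u - r x u)) \<in> dspan loc_polys G" if "x \<in> X" for x
        by (intro dspan_scale[OF S] subring_setD(5)[OF S eloc polys_subset_loc[OF Dpoly]] r_span that)
    qed
    ultimately have "(\<lambda>u. \<delta> w u - s u) \<in> dspan loc_polys G" by simp
    moreover have "u \<in> PT ord G \<and> ord u w" if su: "s u \<noteq> 0" for u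
    proof -
      obtain x where "x \<in> X" "r x u \<noteq> 0"
        using su unfolding s_def by (metis (mono_tags, lifting) mult_zero_right neg_equal_0_iff_equal sum.neutral)
      then have "u \<in> PT ord G" "u = x \<or> ord u x" "ord x w" using r by (auto simp: X_def)
      then show ?thesis using ord_trans by metis
    qed
    ultimately have "normal_form w s" unfolding normal_form_def \<delta>_def by blast
    then show ?thesis by blast
  qed
qed

lemma solutions_if_ordinary:
  assumes "ordinary_origin ord G"
  shows "\<exists>S. finite S \<and> card S = rank ord G \<and> lin_indep_ser S \<and>
    (\<forall>f\<in>S. f \<noteq> (\<lambda>_. 0) \<and> is_solution G f) \<and> init_exp ord ` S = PT ord G"
proof -
  note S = subring_set_loc_polys
  let ?A = "PT ord G"
  define \<delta> :: "'v mon \<Rightarrow> 'v mon \<Rightarrow> ('v, 'a) mps" where "\<delta> x u = (if u = x then 1 else 0)" for x u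
  \<comment> \<open>Taking each parametric term as its own remainder makes the series
    \<open>f a\<close> dual to the parametric terms.\<close>
  have "\<forall>w. \<exists>r. normal_form w r \<and> (w \<in> ?A \<longrightarrow> r = \<delta> w)"
  proof
    fix w
    show "\<exists>r. normal_form w r \<and> (w \<in> ?A \<longrightarrow> r = \<delta> w)"
    proof (cases "w \<in> ?A")
      case True
      then have "normal_form w (\<delta> w)" using normal_form_PT unfolding \<delta>_def by blast
      then show ?thesis by blast
    next
      case False
      then show ?thesis using normal_form_exists assms unfolding ordinary_origin_iff by blast
    qed
  qed
  then obtain r where nf: "\<forall>w. normal_form w (r w) \<and> (w \<in> ?A \<longrightarrow> r w = \<delta> w)"
    using choice by metis
  have r: "u \<in> ?A \<and> (u = w \<or> ord u w)" if "r w u \<noteq> 0" for w u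
    using nf that unfolding normal_form_def by blast
  have r_span: "(\<lambda>u. \<delta> w u - r w u) \<in> dspan loc_polys G" for w
    using nf unfolding normal_form_def \<delta>_def by blast
  have r_PT: "r w = \<delta> w" if "w \<in> ?A" for w using nf that by blast
  \<comment> \<open>The derivative of order \<open>w\<close> at the origin is prescribed to be
    \<open>coef (r w a) 0\<close>: the series encodes the functional that reduces
    \<open>\<partial>\<^sup>w\<close> and reads off the coefficient at \<open>a\<close> at the
    origin.\<close>
  define f where "f a = (\<lambda>w. coef (r w a) 0 / of_nat (mfact w))" for a
  have sol: "is_solution G (f a)" for a
    unfolding is_solution_def
  proof (intro ballI ext)
    fix P v assume P: "P \<in> G"
    define L where "L = dshift v P"
    define X where "X = {w. L w \<noteq> 0}"
    have finX: "finite X" using finite_dshift_support[OF P] by (simp add: X_def L_def)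
    \<comment> \<open>The remainder of \<open>\<partial>\<^sup>v P\<close>: it differs from
      \<open>L\<close> by an element of the span, hence lies in the span itself while being
      supported on \<open>PT\<close>.\<close>
    define N where "N u = (\<Sum>w\<in>X. L w * r w u)" for u
    have "N u = L u - (\<Sum>w\<in>X. L w * (\<delta> w u - r w u))" for u
    proof -
      have "(\<Sum>w\<in>X. L w * \<delta> w u) = (\<Sum>w\<in>X. if w = u then L u else 0)"
        by (intro sum.cong) (auto simp: \<delta>_def)
      also have "\<dots> = L u" using finX by (simp add: X_def)
      finally show ?thesis unfolding N_def right_diff_distrib sum_subtractf by simp
    qed
    moreover have "(\<lambda>u. L u - (\<Sum>w\<in>X. L w * (\<delta> w u - r w u))) \<in> dspan loc_polys G"
    proof (intro dspan_diff[OF S] dspan_sum)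
      show "L \<in> dspan loc_polys G" unfolding L_def by (rule dspan_gen[OF S P])
      show "(\<lambda>u. L w * (\<delta> w u - r w u)) \<in> dspan loc_polys G" for w
        unfolding L_def
        by (intro dspan_scale[OF S] polys_subset_loc dshift_in_polys dop[OF P] r_span)
    qed
    ultimately have "N \<in> dspan loc_polys G" by (metis (no_types, lifting) ext)
    moreover have "u \<in> ?A" if "N u \<noteq> 0" for u
      using that r unfolding N_def by (metis (mono_tags, lifting) mult_zero_right sum.neutral)
    ultimately have "N a = 0" by (rule dspan_PT_zero)
    then have "coef (N a) 0 = 0" by simp
    then have "(\<Sum>w\<in>X. coef (L w) 0 * coef (r w a) 0) = 0" unfolding N_def coef_sum coef_mult_0 .
    then have "of_nat (mfact v) * dapply P (f a) v = 0"
      using mfact_dapply[OF dop[OF P] finX, of v "\<lambda>w. coef (r w a) 0"]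
      unfolding f_def X_def L_def by simp
    then show "dapply P (f a) v = 0" using mfact_pos[of v] by simp
  qed
  have fA: "f a w = (if w = a then 1 / of_nat (mfact a) else 0)" if "w \<in> ?A" for a w
    using r_PT[OF that] by (simp add: f_def \<delta>_def)
  have faa: "f a a \<noteq> 0" if "a \<in> ?A" for a using fA[OF that, of a] mfact_pos[of a] by simp
  \<comment> \<open>The remainder of \<open>\<partial>\<^sup>w\<close> has no term above
    \<open>w\<close>, in particular none at \<open>a\<close>.\<close>
  have f_below: "f a w = 0" if "ord w a" for a w
  proof -
    have "r w a = 0" using r that ord_antisym ord_irrefl by metis
    then show ?thesis by (simp add: f_def)
  qed
  have init: "init_exp ord (f a) = a" if "a \<in> ?A" for a
    using faa[OF that] f_below by (intro init_exp_eqI) auto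
  have inj: "inj_on f ?A" using init by (metis inj_onI)
  have "lin_indep_ser (f ` ?A)"
    unfolding lin_indep_ser_def
  proof (intro allI impI ballI)
    fix c g assume c: "(\<lambda>w. \<Sum>f\<in>f ` ?A. c f * f w) = (\<lambda>_. 0)" and "g \<in> f ` ?A"
    then obtain a where a: "a \<in> ?A" "g = f a" by blast
    have "0 = (\<Sum>f\<in>f ` ?A. c f * f a)" using fun_cong[OF c, of a] by simp
    also have "\<dots> = (\<Sum>b\<in>?A. c (f b) * f b a)" using sum.reindex[OF inj] by simp
    also have "\<dots> = (\<Sum>b\<in>?A. if b = a then c (f a) * f a a else 0)"
      by (intro sum.cong) (auto simp: fA[OF a(1)])
    also have "\<dots> = c (f a) * f a a" using a(1) finite_PT by simp
    finally show "c g = 0" using faa[OF a(1)] a(2) by simp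
  qed
  moreover have "card (f ` ?A) = rank ord G" using card_image[OF inj] by (simp add: rank_def)
  moreover have "init_exp ord ` f ` ?A = ?A" using init by (force simp: image_image)
  moreover have "f a \<noteq> (\<lambda>_. 0)" if "a \<in> ?A" for a using faa[OF that] by auto
  ultimately show ?thesis using finite_PT sol by (intro exI[of _ "f ` ?A"]) auto
qed

end

theorem mainTheorem5:
  fixes ord :: "'v::finite mon \<Rightarrow> 'v mon \<Rightarrow> bool"
    and G :: "('v, 'a::field_char_0) dop set"
  assumes "graded_term_order ord"
    and "finite G"
    and "\<forall>g\<in>G. is_dop g"
    and "is_GB ord G"
    and "is_reduced ord G"
    and "\<forall>g\<in>G. primitive g"
    and "D_finite G"
  shows "ordinary_origin ord G \<longleftrightarrow>
    (\<exists>S. finite S \<and> card S = rank ord G \<and> lin_indep_ser S \<and>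
         (\<forall>f\<in>S. f \<noteq> (\<lambda>_. 0) \<and> is_solution G f) \<and>
         init_exp ord ` S = PT ord G)"
proof -
  interpret groebner_basis ord G
    using assms by (simp add: groebner_basis_def groebner_basis_axioms_def graded_order_def)
  show ?thesis
  proof
    show "ordinary_origin ord G" if "\<exists>S. finite S \<and> card S = rank ord G \<and> lin_indep_ser S \<and>
        (\<forall>f\<in>S. f \<noteq> (\<lambda>_. 0) \<and> is_solution G f) \<and> init_exp ord ` S = PT ord G"
    proof -
      from that obtain S where S: "\<forall>f\<in>S. f \<noteq> (\<lambda>_. 0) \<and> is_solution G f" "init_exp ord ` S = PT ord G"
        by auto
      show ?thesis by (rule ordinary_if_solutions[OF _ _ S(2)]) (use assms(6) S(1) in simp_all)
    qed
  qed (rule solutions_if_ordinary)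
qed

end
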